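(* Let $M$ be an $m$-dimensional proper biharmonic submanifold with parallel mean curvature vector field $H$ (i.e. $\nabla^\perp H=0$) in the unit Euclidean sphere $\mathbb{S}^n$. Then (i) $|A_H|^2=m|H|^2$, and it is constant; (ii) $\operatorname{trace}\nabla A_H=0$; (iii) $\langle \operatorname{trace}(\nabla^\perp B)(X,\cdot,A_H(\cdot)),H\rangle=\langle \operatorname{trace}(\nabla^\perp B)(\cdot,X,A_H(\cdot)),H\rangle=0$ for all $X\in C(TM)$.
   Context: Manifolds are smooth and connected. For a smooth map $\phi:(M,g)\to(N,h)$ between Riemannian manifolds, the tension field is $\tau(\phi)=\operatorname{trace}\nabla d\phi$; $\phi$ is harmonic if $\tau(\phi)=0$, and biharmonic if its bitension field vanishes: $$\tau_2(\phi)=-\Delta\tau(\phi)-\operatorname{trace}R^N(d\phi(\cdot),\tau(\phi))d\phi(\cdot)=0,$$ where $\Delta=-\operatorname{trace}\nabla^2$ is the rough Laplacian on sections of $\phi^{-1}TN$ and $R^N(X,Y)=[\nabla_X,\nabla_Y]-\nabla_{[X,Y]}$. A submanifold $M$ of $N$ is proper biharmonic if its inclusion map (with the induced metric) is biharmonic but not harmonic (equivalently, biharmonic and not minimal). For a submanifold $M^m$ of $\mathbb{S}^n$: $B$ is the second fundamental form, $H=\frac1m\operatorname{trace}B$ the mean curvature vector field, $\nabla^\perp$ the normal connection, $\nabla$ the Levi-Civita connection of $M$, and $A$ the Weingarten operator, $\langle A_\xi X,Y\rangle=\langle B(X,Y),\xi\rangle$ for normal $\xi$. $C(TM)$ denotes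 the smooth vector fields on $M$. The covariant derivative of $B$ is $(\nabla^\perp B)(X,Y,Z)=\nabla^\perp_X B(Y,Z)-B(\nabla_XY,Z)-B(Y,\nabla_XZ)$. For a local orthonormal frame $\{E_i\}_{i=1}^m$ of $M$: $\operatorname{trace}\nabla A_H=\sum_i(\nabla_{E_i}A_H)(E_i)$, $\operatorname{trace}(\nabla^\perp B)(X,\cdot,A_H(\cdot))=\sum_i(\nabla^\perp B)(X,E_i,A_H(E_i))$, $\operatorname{trace}(\nabla^\perp B)(\cdot,X,A_H(\cdot))=\sum_i(\nabla^\perp B)(E_i,X,A_H(E_i))$. *)

theory Defs
  imports "HOL-Analysis.Analysis"
begin

section \<open>Smooth maps between Euclidean spaces\<close>

primrec Ck_on :: "nat \<Rightarrow> 'a::real_normed_vector set \<Rightarrow> ('a \<Rightarrow> 'b::real_normed_vector) \<Rightarrow> bool" where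
  "Ck_on 0 S f = continuous_on S f"
| "Ck_on (Suc k) S f =
    ((\<forall>x\<in>S. f differentiable (at x)) \<and> (\<forall>v. Ck_on k S (\<lambda>x. frechet_derivative f (at x) v)))"

(* Only meaningful for open S. *)
definition smooth_on :: "'a::real_normed_vector set \<Rightarrow> ('a \<Rightarrow> 'b::real_normed_vector) \<Rightarrow> bool" where
  "smooth_on S f \<longleftrightarrow> (\<forall>k. Ck_on k S f)"

definition orth_proj :: "'e::euclidean_space set \<Rightarrow> 'e \<Rightarrow> 'e" where
  "orth_proj T v = (THE t. t \<in> T \<and> (\<forall>w\<in>T. (v - t) \<bullet> w = 0))"


section \<open>The unit sphere as a Riemannian manifold\<close>

definition sphere_tangent :: "'e::euclidean_space \<Rightarrow> 'e set" where
  "sphere_tangent y = {v. v \<bullet> y = 0}"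

(* Derivative of a map defined on the unit sphere at y in the tangent direction v:
   sgn is the radial retraction of the punctured space onto the unit sphere, so this
   uses only the values of F on the sphere. *)
definition sphere_deriv :: "('e::euclidean_space \<Rightarrow> 'e) \<Rightarrow> 'e \<Rightarrow> 'e \<Rightarrow> 'e" where
  "sphere_deriv F y v = frechet_derivative (\<lambda>z. F (sgn z)) (at y) v"

(* The Levi-Civita connection of the round metric is the tangential part of the flat one. *)
definition sphere_conn :: "('e::euclidean_space \<Rightarrow> 'e) \<Rightarrow> ('e \<Rightarrow> 'e) \<Rightarrow> 'e \<Rightarrow> 'e" where
  "sphere_conn X Y y = orth_proj (sphere_tangent y) (sphere_deriv Y y (X y))"

definition sphere_bracket :: "('e::euclidean_space \<Rightarrow> 'e) \<Rightarrow> ('e \<Rightarrow> 'e) \<Rightarrow> 'e \<Rightarrow> 'e" where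
  "sphere_bracket X Y y = sphere_deriv Y y (X y) - sphere_deriv X y (Y y)"

definition sphere_curvature_field ::
    "('e::euclidean_space \<Rightarrow> 'e) \<Rightarrow> ('e \<Rightarrow> 'e) \<Rightarrow> ('e \<Rightarrow> 'e) \<Rightarrow> 'e \<Rightarrow> 'e" where
  "sphere_curvature_field X Y Z y =
     sphere_conn X (sphere_conn Y Z) y - sphere_conn Y (sphere_conn X Z) y
       - sphere_conn (sphere_bracket X Y) Z y"

(* The curvature is a tensor, so its value on tangent vectors a, b, c at y may be computed with
   any smooth tangent fields extending them; here a is extended by the tangential part of the
   constant field a. *)
definition sphere_curvature :: "'e::euclidean_space \<Rightarrow> 'e \<Rightarrow> 'e \<Rightarrow> 'e \<Rightarrow> 'e" where
  "sphere_curvature y a b c =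
     sphere_curvature_field (\<lambda>q. orth_proj (sphere_tangent q) a)
       (\<lambda>q. orth_proj (sphere_tangent q) b) (\<lambda>q. orth_proj (sphere_tangent q) c) y"


section \<open>Smooth manifolds and immersions into the sphere\<close>

(* A manifold modelled on 'm with a map to the Euclidean space 'e. The atlas consists of local
   parametrizations (V, x), i.e. inverse charts x defined on an open set V of 'm. The topology is
   part of the data, so that it need not be the one induced by the ambient space. *)
record ('a, 'm, 'e) mapped_manifold =
  mtop :: "'a topology"
  atlas :: "('m set \<times> ('m \<Rightarrow> 'a)) set"
  imm :: "'a \<Rightarrow> 'e"

definition smooth_manifold :: "('a, 'm::euclidean_space, 'e::euclidean_space) mapped_manifold \<Rightarrow> bool" where
  "smooth_manifold M \<longleftrightarrow>
     Hausdorff_space (mtop M) \<and> second_countable (mtop M) \<and> connected_space (mtop M) \<and>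
     (\<forall>(V, x)\<in>atlas M. open V \<and> openin (mtop M) (x ` V) \<and>
        homeomorphic_map (top_of_set V) (subtopology (mtop M) (x ` V)) x) \<and>
     topspace (mtop M) = (\<Union>(V, x)\<in>atlas M. x ` V) \<and>
     (\<forall>(V, x)\<in>atlas M. \<forall>(W, y)\<in>atlas M.
        smooth_on {u \<in> V. x u \<in> y ` W} (\<lambda>u. inv_into W y (x u)))"

definition smooth_fun_on ::
    "('a, 'm::euclidean_space, 'e::euclidean_space) mapped_manifold \<Rightarrow> 'a set
      \<Rightarrow> ('a \<Rightarrow> 'b::real_normed_vector) \<Rightarrow> bool" where
  "smooth_fun_on M U f \<longleftrightarrow> (\<forall>(V, x)\<in>atlas M. smooth_on {u \<in> V. x u \<in> U} (\<lambda>u. f (x u)))"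

(* A submanifold of the unit sphere is an immersed one; for the inclusion of a subset M of the
   sphere, 'a is 'e and imm is the identity. The metric is always the induced one. *)
definition sphere_submanifold ::
    "('a, 'm::euclidean_space, 'e::euclidean_space) mapped_manifold \<Rightarrow> bool" where
  "sphere_submanifold M \<longleftrightarrow>
     smooth_manifold M \<and>
     imm M ` topspace (mtop M) \<subseteq> sphere 0 1 \<and>
     smooth_fun_on M (topspace (mtop M)) (imm M) \<and>
     (\<forall>(V, x)\<in>atlas M. \<forall>u\<in>V. inj (frechet_derivative (\<lambda>u. imm M (x u)) (at u)))"

(* Tangent vectors are identified with their images under the differential of the immersion, so
   the induced metric is the ambient inner product and vector fields are maps 'a => 'e. *)
definition tangent_space ::
    "('a, 'm::euclidean_space, 'e::euclidean_space) mapped_manifold \<Rightarrow> 'a \<Rightarrow> 'e set" where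
  "tangent_space M p =
     {v. \<exists>(V, x)\<in>atlas M. \<exists>u\<in>V. x u = p \<and> v \<in> range (frechet_derivative (\<lambda>u. imm M (x u)) (at u))}"

definition normal_space ::
    "('a, 'm::euclidean_space, 'e::euclidean_space) mapped_manifold \<Rightarrow> 'a \<Rightarrow> 'e set" where
  "normal_space M p = {v \<in> sphere_tangent (imm M p). \<forall>w\<in>tangent_space M p. v \<bullet> w = 0}"

(* The differential of f at p applied to a tangent vector v: if v has coordinates w in a
   parametrization x with x u = p, this is the derivative of f o x at u in direction w. *)
definition mderiv ::
    "('a, 'm::euclidean_space, 'e::euclidean_space) mapped_manifold
      \<Rightarrow> ('a \<Rightarrow> 'b::real_normed_vector) \<Rightarrow> 'a \<Rightarrow> 'e \<Rightarrow> 'b" where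
  "mderiv M f p v =
     (THE d. \<exists>(V, x)\<in>atlas M. \<exists>u\<in>V. \<exists>w. x u = p \<and>
        frechet_derivative (\<lambda>u. imm M (x u)) (at u) w = v \<and>
        frechet_derivative (\<lambda>u. f (x u)) (at u) w = d)"

definition tangent_field_on ::
    "('a, 'm::euclidean_space, 'e::euclidean_space) mapped_manifold
      \<Rightarrow> 'a set \<Rightarrow> ('a \<Rightarrow> 'e) \<Rightarrow> bool" where
  "tangent_field_on M U X \<longleftrightarrow>
     openin (mtop M) U \<and> smooth_fun_on M U X \<and> (\<forall>p\<in>U. X p \<in> tangent_space M p)"

definition orthonormal_frame_on ::
    "('a, 'm::euclidean_space, 'e::euclidean_space) mapped_manifold
      \<Rightarrow> 'a set \<Rightarrow> (nat \<Rightarrow> 'a \<Rightarrow> 'e) \<Rightarrow> bool" where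
  "orthonormal_frame_on M U E \<longleftrightarrow>
     (\<forall>i<DIM('m). tangent_field_on M U (E i)) \<and>
     (\<forall>p\<in>U. \<forall>i<DIM('m). \<forall>j<DIM('m). E i p \<bullet> E j p = (if i = j then 1 else 0))"

(* Trace at p of a bilinear expression F in tangent fields. The frame is picked
   arbitrarily; for tensorial F the result does not depend on it. *)
definition trace_at ::
    "('a, 'm::euclidean_space, 'e::euclidean_space) mapped_manifold
      \<Rightarrow> (('a \<Rightarrow> 'e) \<Rightarrow> ('a \<Rightarrow> 'e) \<Rightarrow> 'a \<Rightarrow> 'b::comm_monoid_add) \<Rightarrow> 'a \<Rightarrow> 'b" where
  "trace_at M F p =
     (let E = (SOME E. \<exists>U. p \<in> U \<and> orthonormal_frame_on M U E)
      in \<Sum>i<DIM('m). F (E i) (E i) p)"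


section \<open>Harmonic and biharmonic maps into the sphere\<close>

(* The connection on the pull-back of the tangent bundle of the sphere by f, i.e. the Levi-Civita
   connection of the sphere along f. *)
definition pullback_conn ::
    "('a, 'm::euclidean_space, 'e::euclidean_space) mapped_manifold
      \<Rightarrow> ('a \<Rightarrow> 'f::euclidean_space) \<Rightarrow> ('a \<Rightarrow> 'e) \<Rightarrow> ('a \<Rightarrow> 'f) \<Rightarrow> 'a \<Rightarrow> 'f" where
  "pullback_conn M f X V p = orth_proj (sphere_tangent (f p)) (mderiv M V p (X p))"

(* The Levi-Civita connection of the induced metric is the tangential part of the ambient one. *)
definition levi_civita ::
    "('a, 'm::euclidean_space, 'e::euclidean_space) mapped_manifold
      \<Rightarrow> ('a \<Rightarrow> 'e) \<Rightarrow> ('a \<Rightarrow> 'e) \<Rightarrow> 'a \<Rightarrow> 'e" where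
  "levi_civita M X Y p = orth_proj (tangent_space M p) (pullback_conn M (imm M) X Y p)"

(* The differential of f applied to a tangent field. *)
definition dmap ::
    "('a, 'm::euclidean_space, 'e::euclidean_space) mapped_manifold
      \<Rightarrow> ('a \<Rightarrow> 'f::euclidean_space) \<Rightarrow> ('a \<Rightarrow> 'e) \<Rightarrow> 'a \<Rightarrow> 'f" where
  "dmap M f X p = mderiv M f p (X p)"

definition nabla_dmap ::
    "('a, 'm::euclidean_space, 'e::euclidean_space) mapped_manifold
      \<Rightarrow> ('a \<Rightarrow> 'f::euclidean_space) \<Rightarrow> ('a \<Rightarrow> 'e) \<Rightarrow> ('a \<Rightarrow> 'e) \<Rightarrow> 'a \<Rightarrow> 'f" where
  "nabla_dmap M f X Y p = pullback_conn M f X (dmap M f Y) p - dmap M f (levi_civita M X Y) p"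

definition tension_field ::
    "('a, 'm::euclidean_space, 'e::euclidean_space) mapped_manifold
      \<Rightarrow> ('a \<Rightarrow> 'f::euclidean_space) \<Rightarrow> 'a \<Rightarrow> 'f" where
  "tension_field M f p = trace_at M (nabla_dmap M f) p"

definition rough_laplacian ::
    "('a, 'm::euclidean_space, 'e::euclidean_space) mapped_manifold
      \<Rightarrow> ('a \<Rightarrow> 'f::euclidean_space) \<Rightarrow> ('a \<Rightarrow> 'f) \<Rightarrow> 'a \<Rightarrow> 'f" where
  "rough_laplacian M f V p =
     - trace_at M (\<lambda>X Y q. pullback_conn M f X (pullback_conn M f Y V) q
                           - pullback_conn M f (levi_civita M X Y) V q) p"

definition bitension_field ::
    "('a, 'm::euclidean_space, 'e::euclidean_space) mapped_manifold
      \<Rightarrow> ('a \<Rightarrow> 'f::euclidean_space) \<Rightarrow> 'a \<Rightarrow> 'f" where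
  "bitension_field M f p =
     - rough_laplacian M f (tension_field M f) p
     - trace_at M (\<lambda>X Y q. sphere_curvature (f q) (dmap M f X q) (tension_field M f q) (dmap M f Y q)) p"

definition harmonic_map ::
    "('a, 'm::euclidean_space, 'e::euclidean_space) mapped_manifold
      \<Rightarrow> ('a \<Rightarrow> 'f::euclidean_space) \<Rightarrow> bool" where
  "harmonic_map M f \<longleftrightarrow> (\<forall>p\<in>topspace (mtop M). tension_field M f p = 0)"

definition biharmonic_map ::
    "('a, 'm::euclidean_space, 'e::euclidean_space) mapped_manifold
      \<Rightarrow> ('a \<Rightarrow> 'f::euclidean_space) \<Rightarrow> bool" where
  "biharmonic_map M f \<longleftrightarrow> (\<forall>p\<in>topspace (mtop M). bitension_field M f p = 0)"

definition proper_biharmonic_submanifold ::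
    "('a, 'm::euclidean_space, 'e::euclidean_space) mapped_manifold \<Rightarrow> bool" where
  "proper_biharmonic_submanifold M \<longleftrightarrow>
     sphere_submanifold M \<and> biharmonic_map M (imm M) \<and> \<not> harmonic_map M (imm M)"


section \<open>Extrinsic geometry of submanifolds of the sphere\<close>

definition second_fundamental_form ::
    "('a, 'm::euclidean_space, 'e::euclidean_space) mapped_manifold
      \<Rightarrow> ('a \<Rightarrow> 'e) \<Rightarrow> ('a \<Rightarrow> 'e) \<Rightarrow> 'a \<Rightarrow> 'e" where
  "second_fundamental_form M X Y p =
     orth_proj (normal_space M p) (pullback_conn M (imm M) X Y p)"

definition mean_curvature ::
    "('a, 'm::euclidean_space, 'e::euclidean_space) mapped_manifold \<Rightarrow> 'a \<Rightarrow> 'e" where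
  "mean_curvature M p = (1 / real DIM('m)) *\<^sub>R trace_at M (second_fundamental_form M) p"

definition normal_conn ::
    "('a, 'm::euclidean_space, 'e::euclidean_space) mapped_manifold
      \<Rightarrow> ('a \<Rightarrow> 'e) \<Rightarrow> ('a \<Rightarrow> 'e) \<Rightarrow> 'a \<Rightarrow> 'e" where
  "normal_conn M X \<xi> p = orth_proj (normal_space M p) (pullback_conn M (imm M) X \<xi> p)"

definition parallel_mean_curvature ::
    "('a, 'm::euclidean_space, 'e::euclidean_space) mapped_manifold \<Rightarrow> bool" where
  "parallel_mean_curvature M \<longleftrightarrow>
     (\<forall>U X. tangent_field_on M U X \<longrightarrow> (\<forall>p\<in>U. normal_conn M X (mean_curvature M) p = 0))"

definition weingarten ::
    "('a, 'm::euclidean_space, 'e::euclidean_space) mapped_manifold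
      \<Rightarrow> ('a \<Rightarrow> 'e) \<Rightarrow> ('a \<Rightarrow> 'e) \<Rightarrow> 'a \<Rightarrow> 'e" where
  "weingarten M \<xi> X p =
     (THE z. z \<in> tangent_space M p \<and>
        (\<forall>U Y. p \<in> U \<and> tangent_field_on M U Y \<longrightarrow>
           z \<bullet> Y p = second_fundamental_form M X Y p \<bullet> \<xi> p))"

definition weingarten_norm2 ::
    "('a, 'm::euclidean_space, 'e::euclidean_space) mapped_manifold
      \<Rightarrow> ('a \<Rightarrow> 'e) \<Rightarrow> 'a \<Rightarrow> real" where
  "weingarten_norm2 M \<xi> p = trace_at M (\<lambda>X Y q. weingarten M \<xi> X q \<bullet> weingarten M \<xi> Y q) p"

definition nabla_weingarten ::
    "('a, 'm::euclidean_space, 'e::euclidean_space) mapped_manifold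
      \<Rightarrow> ('a \<Rightarrow> 'e) \<Rightarrow> ('a \<Rightarrow> 'e) \<Rightarrow> ('a \<Rightarrow> 'e) \<Rightarrow> 'a \<Rightarrow> 'e" where
  "nabla_weingarten M \<xi> X Y p =
     levi_civita M X (weingarten M \<xi> Y) p - weingarten M \<xi> (levi_civita M X Y) p"

definition nabla_second_fundamental_form ::
    "('a, 'm::euclidean_space, 'e::euclidean_space) mapped_manifold
      \<Rightarrow> ('a \<Rightarrow> 'e) \<Rightarrow> ('a \<Rightarrow> 'e) \<Rightarrow> ('a \<Rightarrow> 'e) \<Rightarrow> 'a \<Rightarrow> 'e" where
  "nabla_second_fundamental_form M X Y Z p =
     normal_conn M X (second_fundamental_form M Y Z) p
     - second_fundamental_form M (levi_civita M X Y) Z p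
     - second_fundamental_form M Y (levi_civita M X Z) p"

end

theory Submission
  imports Defs
begin

text \<open>
  Identify tangent vectors with vectors of the ambient Euclidean space. If the mean curvature field
  \<open>H\<close> is parallel, then the flat derivative of \<open>H\<close> along \<open>X\<close> is tangent and
  equals \<open>- A\<^sub>H X\<close>, and the tension field is \<open>m H\<close>. The biharmonic equation thus becomes
  \<open>trace \<nabla>A\<^sub>H + \<Sum>\<^sub>i B(E\<^sub>i, A\<^sub>H E\<^sub>i) = m H\<close>: its tangential part is (ii), and its inner product with
  \<open>H\<close> is (i), the norm of a parallel field being constant. Pairing \<open>\<nabla>B\<close> with \<open>H\<close> turns the first
  trace in (iii) into \<open>\<Sum>\<^sub>i \<langle>(\<nabla>\<^sub>X A\<^sub>H) E\<^sub>i, A\<^sub>H E\<^sub>i\<rangle>\<close>, which is half the derivative of the constant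
  \<open>|A\<^sub>H|\<^sup>2\<close>, and the Codazzi equation for \<open>A\<^sub>H\<close> (symmetry of the second derivatives of \<open>H\<close>)
  identifies it with the second one.
\<close>

section \<open>Calculus of smooth maps\<close>

text \<open>Fields such as \<open>mean_curvature M\<close> are traces whose frame is chosen
  separately at each point by \<open>SOME\<close>, so even their differentiability is not evident.
  Independence of the frame, which rests on tensoriality of the second fundamental form, replaces
  them near a point by a formula in one smooth frame; \<open>weingarten_norm2\<close> is treated in
  the same way before it is differentiated. Traces that are only evaluated at a point are read off
  in the chosen frame, which depends on the point alone and is shared by all traces there. Tangency
  of D_X H has two sources: parallelism removes the normal part, and orthogonality of H to the
  position vector removes the radial part. The factor m on the right of the biharmonic equation
  comes from curvature: each of the m terms R(E_i, m H) E_i equals - m H on the unit sphere, and one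
  factor m cancels. In (iii) the frame is not adapted to the point. Its connection coefficients
  along X are skew and cancel against the symmetric products <A_H E_i, A_H E_j>.\<close>

lemma frechet_derivative_eqI:
  "(f has_derivative f') (at x) \<Longrightarrow> frechet_derivative f (at x) = f'"
  by (rule frechet_derivative_at[symmetric])

section \<open>Closure properties of the classes of C^k maps\<close>

lemma Ck_on_imp_continuous_on: "Ck_on k S f \<Longrightarrow> continuous_on S f"
  by (cases k)
    (simp_all add: differentiable_imp_continuous_within continuous_at_imp_continuous_on)

text \<open>\<open>Ck_on (Suc k)\<close> speaks only of derivatives, so lower orders have to be
  recovered. The product, composition and power rules rely on this, because there a map reappears
  next to its derivative.\<close>

lemma Ck_on_SucD: "Ck_on (Suc k) S f \<Longrightarrow> Ck_on k S f"
proof (induction k arbitrary: f)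
  case 0
  then show ?case using Ck_on_imp_continuous_on by (metis Ck_on.simps(1))
next
  case (Suc k)
  have "Ck_on (Suc k) S (\<lambda>x. frechet_derivative f (at x) v)" for v
    using Suc.prems by simp
  then have "Ck_on k S (\<lambda>x. frechet_derivative f (at x) v)" for v
    using Suc.IH by blast
  then show ?case using Suc.prems by simp
qed

lemma Ck_on_subset: "Ck_on k S f \<Longrightarrow> T \<subseteq> S \<Longrightarrow> Ck_on k T f"
  by (induction k arbitrary: f) (auto intro: continuous_on_subset)

text \<open>Openness of \<open>S\<close> matters: \<open>frechet_derivative\<close> at a point sees
  the values in a whole neighbourhood, so agreement on an open set passes to derivatives of every
  order.\<close>

lemma Ck_on_cong:
  assumes "open S" "\<And>x. x \<in> S \<Longrightarrow> f x = g x" "Ck_on k S f"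
  shows "Ck_on k S g"
  using assms(2,3)
proof (induction k arbitrary: f g)
  case 0
  then show ?case using continuous_on_cong by (metis Ck_on.simps(1))
next
  case (Suc k)
  have d: "(g has_derivative frechet_derivative f (at x)) (at x)" if "x \<in> S" for x
    using Suc.prems(2) that
    by (intro has_derivative_transform_within_open[OF _ assms(1) that Suc.prems(1)])
      (simp_all add: frechet_derivative_works)
  have "Ck_on k S (\<lambda>x. frechet_derivative g (at x) v)" for v
    using Suc.prems(2) by (rule_tac Suc.IH[of "\<lambda>x. frechet_derivative f (at x) v"])
      (simp_all add: frechet_derivative_eqI[OF d])
  moreover have "\<forall>x\<in>S. g differentiable (at x)"
    using d by (auto simp: differentiable_def)
  ultimately show ?case by simp
qed

text \<open>Allows a different formula around each point. Coordinates of tangent fields are handled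
  this way, since smooth orthonormal frames are constructed only locally.\<close>

lemma Ck_on_local:
  assumes "\<And>x. x \<in> S \<Longrightarrow> \<exists>T. open T \<and> x \<in> T \<and> Ck_on k T f"
  shows "Ck_on k S f"
  using assms
proof (induction k arbitrary: f)
  case 0
  have "isCont f x" if x: "x \<in> S" for x
  proof -
    obtain T where "open T" "x \<in> T" "continuous_on T f" using 0 x by auto
    then show ?thesis by (simp add: continuous_on_eq_continuous_at)
  qed
  then show ?case by (simp add: continuous_at_imp_continuous_on)
next
  case (Suc k)
  have "Ck_on k S (\<lambda>x. frechet_derivative f (at x) v)" for v
    using Suc.prems by (intro Suc.IH) fastforce
  moreover have "\<forall>x\<in>S. f differentiable (at x)"
    using Suc.prems by fastforce
  ultimately show ?case by simp
qed

lemma Ck_on_const: "Ck_on k S (\<lambda>x. c)"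
  by (induction k arbitrary: c) (auto simp: continuous_on_const)

lemma Ck_on_add:
  assumes "open S" "Ck_on k S f" "Ck_on k S g"
  shows "Ck_on k S (\<lambda>x. f x + g x)"
  using assms(2,3)
proof (induction k arbitrary: f g)
  case 0
  then show ?case by (simp add: continuous_on_add)
next
  case (Suc k)
  have "Ck_on k S (\<lambda>x. frechet_derivative (\<lambda>x. f x + g x) (at x) v)" for v
  proof (rule Ck_on_cong[OF assms(1)])
    show "Ck_on k S (\<lambda>x. frechet_derivative f (at x) v + frechet_derivative g (at x) v)"
      using Suc.prems by (intro Suc.IH) auto
    fix x assume "x \<in> S"
    then have "((\<lambda>x. f x + g x) has_derivative
        (\<lambda>v. frechet_derivative f (at x) v + frechet_derivative g (at x) v)) (at x)"
      using Suc.prems by (intro has_derivative_add) (auto simp: frechet_derivative_works)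
    then show "frechet_derivative f (at x) v + frechet_derivative g (at x) v =
        frechet_derivative (\<lambda>x. f x + g x) (at x) v"
      by (simp add: frechet_derivative_eqI)
  qed
  then show ?case using Suc.prems by simp
qed

text \<open>The derivative is a sum of products of the mixed pairs (f, g') and (f', g), which is why
  the induction keeps both factors arbitrary. Scalar multiplication and the inner product are the
  instances used.\<close>

lemma (in bounded_bilinear) Ck_on_prod:
  assumes "open S" "Ck_on k S f" "Ck_on k S g"
  shows "Ck_on k S (\<lambda>x. prod (f x) (g x))"
  using assms(2,3)
proof (induction k arbitrary: f g)
  case 0
  then show ?case by (simp add: continuous_on)
next
  case (Suc k)
  have d: "((\<lambda>x. prod (f x) (g x)) has_derivative
      (\<lambda>v. prod (f x) (frechet_derivative g (at x) v) + prod (frechet_derivative f (at x) v) (g x)))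
      (at x)" if "x \<in> S" for x
    using Suc.prems that by (intro FDERIV) (auto simp: frechet_derivative_works)
  have "Ck_on k S (\<lambda>x. frechet_derivative (\<lambda>x. prod (f x) (g x)) (at x) v)" for v
  proof (rule Ck_on_cong[OF assms(1)])
    show "Ck_on k S (\<lambda>x. prod (f x) (frechet_derivative g (at x) v) +
        prod (frechet_derivative f (at x) v) (g x))"
      using Suc.prems Ck_on_SucD[OF Suc.prems(1)] Ck_on_SucD[OF Suc.prems(2)]
      by (intro Ck_on_add assms(1) Suc.IH) auto
  qed (simp add: frechet_derivative_eqI[OF d])
  moreover have "\<forall>x\<in>S. (\<lambda>x. prod (f x) (g x)) differentiable (at x)"
    using d by (auto simp: differentiable_def)
  ultimately show ?case by simp
qed

lemma Ck_on_sum: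
  assumes "open S" "\<And>i. i \<in> I \<Longrightarrow> Ck_on k S (f i)"
  shows "Ck_on k S (\<lambda>x. \<Sum>i\<in>I. f i x)"
  using assms(2)
proof (induction I rule: infinite_finite_induct)
  case (insert i I)
  then show ?case by (simp add: Ck_on_add[OF assms(1)])
qed (simp_all add: Ck_on_const)

lemma linear_expand_Basis:
  fixes w :: "'a::euclidean_space"
  assumes "linear L"
  shows "L w = (\<Sum>b\<in>Basis. (w \<bullet> b) *\<^sub>R L b)"
  by (subst euclidean_representation[of w, symmetric])
    (simp add: linear_sum[OF assms] linear_scale[OF assms])

text \<open>In f'(g x)(g'(x) v) the direction moves with x, so the induction hypothesis does not
  apply directly. Expanding g'(x) v in \<open>Basis\<close> leaves fixed directions b, with
  coefficients of class C^k and partial derivatives of f composed with g.\<close>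

lemma Ck_on_compose:
  fixes g :: "'a::real_normed_vector \<Rightarrow> 'b::euclidean_space"
  assumes "open S" "open T" "g ` S \<subseteq> T" "Ck_on k S g" "Ck_on k T f"
  shows "Ck_on k S (\<lambda>x. f (g x))"
  using assms(4,5)
proof (induction k arbitrary: f)
  case 0
  then show ?case using assms(3) by (auto intro: continuous_on_compose2)
next
  case (Suc k)
  have fd: "f differentiable at (g x)" if "x \<in> S" for x using that Suc.prems assms(3) by auto
  have d: "((\<lambda>x. f (g x)) has_derivative
      (\<lambda>v. frechet_derivative f (at (g x)) (frechet_derivative g (at x) v))) (at x)" if "x \<in> S" for x
    using Suc.prems that fd by (intro has_derivative_compose[of g _ x UNIV f, simplified])
      (auto simp: frechet_derivative_works)
  have "Ck_on k S (\<lambda>x. frechet_derivative (\<lambda>x. f (g x)) (at x) v)" for v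
  proof (rule Ck_on_cong[OF assms(1)])
    show "Ck_on k S (\<lambda>x. \<Sum>b\<in>Basis. (frechet_derivative g (at x) v \<bullet> b) *\<^sub>R
        frechet_derivative f (at (g x)) b)"
      using Suc.prems Ck_on_SucD[OF Suc.prems(1)]
      by (intro Ck_on_sum bounded_bilinear.Ck_on_prod[OF bounded_bilinear_scaleR] assms(1) Suc.IH
          bounded_bilinear.Ck_on_prod[OF bounded_bilinear_inner] Ck_on_const) auto
    fix x assume x: "x \<in> S"
    show "(\<Sum>b\<in>Basis. (frechet_derivative g (at x) v \<bullet> b) *\<^sub>R frechet_derivative f (at (g x)) b)
        = frechet_derivative (\<lambda>x. f (g x)) (at x) v"
      using linear_expand_Basis[OF linear_frechet_derivative[OF fd[OF x]], symmetric]
      by (simp add: frechet_derivative_eqI[OF d[OF x]])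
  qed
  moreover have "\<forall>x\<in>S. (\<lambda>x. f (g x)) differentiable (at x)"
    using d by (auto simp: differentiable_def)
  ultimately show ?case by simp
qed

text \<open>The exponent is arbitrary because differentiation lowers it by one. The case of interest
  is -1/2, for normalizing vectors to length one.\<close>

lemma Ck_on_powr:
  fixes f :: "'a::real_normed_vector \<Rightarrow> real"
  assumes "open S" "\<And>x. x \<in> S \<Longrightarrow> f x > 0" "Ck_on k S f"
  shows "Ck_on k S (\<lambda>x. f x powr a)"
  using assms(3)
proof (induction k arbitrary: a)
  case 0
  then show ?case using assms(2) by (fastforce intro!: continuous_intros)
next
  case (Suc k)
  have d: "((\<lambda>x. f x powr a) has_derivative
      (\<lambda>v. a *\<^sub>R (f x powr (a - 1) *\<^sub>R frechet_derivative f (at x) v))) (at x)" if x: "x \<in> S" for x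
  proof -
    have "((\<lambda>t. t powr a) has_derivative (\<lambda>t. t * (a * f x powr (a - 1)))) (at (f x))"
      using has_real_derivative_powr[OF assms(2)[OF x], of a]
      by (simp add: has_field_derivative_def mult_commute_abs)
    from has_derivative_compose[of f _ x UNIV, simplified, OF _ this]
    show ?thesis using Suc.prems x
      by (auto simp: frechet_derivative_works mult_ac)
  qed
  have "Ck_on k S (\<lambda>x. frechet_derivative (\<lambda>x. f x powr a) (at x) v)" for v
  proof (rule Ck_on_cong[OF assms(1)])
    show "Ck_on k S (\<lambda>x. a *\<^sub>R (f x powr (a - 1) *\<^sub>R frechet_derivative f (at x) v))"
      using Suc.prems Ck_on_SucD[OF Suc.prems]
      by (intro bounded_bilinear.Ck_on_prod[OF bounded_bilinear_scaleR] assms(1) Ck_on_const Suc.IH) auto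
  qed (simp add: frechet_derivative_eqI[OF d])
  moreover have "\<forall>x\<in>S. (\<lambda>x. f x powr a) differentiable (at x)"
    using d by (auto simp: differentiable_def)
  ultimately show ?case by simp
qed

section \<open>Smooth maps and derivatives along variable directions\<close>

lemma smooth_on_subset: "smooth_on S f \<Longrightarrow> T \<subseteq> S \<Longrightarrow> smooth_on T f"
  by (auto simp: smooth_on_def intro: Ck_on_subset)

lemma smooth_on_cong: "smooth_on S f \<Longrightarrow> open S \<Longrightarrow> (\<And>x. x \<in> S \<Longrightarrow> f x = g x) \<Longrightarrow> smooth_on S g"
  by (auto simp: smooth_on_def intro: Ck_on_cong)

lemma smooth_on_local:
  "(\<And>x. x \<in> S \<Longrightarrow> \<exists>T. open T \<and> x \<in> T \<and> smooth_on T f) \<Longrightarrow> smooth_on S f"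
  unfolding smooth_on_def by (intro allI Ck_on_local) blast

lemma smooth_on_const: "smooth_on S (\<lambda>x. c)"
  by (simp add: smooth_on_def Ck_on_const)

lemma smooth_on_add:
  "open S \<Longrightarrow> smooth_on S f \<Longrightarrow> smooth_on S g \<Longrightarrow> smooth_on S (\<lambda>x. f x + g x)"
  by (simp add: smooth_on_def Ck_on_add)

lemma smooth_on_scaleR:
  "open S \<Longrightarrow> smooth_on S f \<Longrightarrow> smooth_on S g \<Longrightarrow> smooth_on S (\<lambda>x. f x *\<^sub>R g x)"
  by (simp add: smooth_on_def bounded_bilinear.Ck_on_prod[OF bounded_bilinear_scaleR])

lemma smooth_on_inner:
  "open S \<Longrightarrow> smooth_on S f \<Longrightarrow> smooth_on S g \<Longrightarrow> smooth_on S (\<lambda>x. f x \<bullet> g x)"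
  by (simp add: smooth_on_def bounded_bilinear.Ck_on_prod[OF bounded_bilinear_inner])

lemma smooth_on_minus: "open S \<Longrightarrow> smooth_on S f \<Longrightarrow> smooth_on S (\<lambda>x. - f x)"
  using smooth_on_scaleR[OF _ smooth_on_const[of S "-1"], of f] by simp

lemma smooth_on_diff:
  "open S \<Longrightarrow> smooth_on S f \<Longrightarrow> smooth_on S g \<Longrightarrow> smooth_on S (\<lambda>x. f x - g x)"
  using smooth_on_add[of S f "\<lambda>x. - g x"] by (simp add: smooth_on_minus)

lemma smooth_on_sum:
  "open S \<Longrightarrow> (\<And>i. i \<in> I \<Longrightarrow> smooth_on S (f i)) \<Longrightarrow> smooth_on S (\<lambda>x. \<Sum>i\<in>I. f i x)"
  by (simp add: smooth_on_def Ck_on_sum)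

lemma smooth_on_compose:
  fixes g :: "'a::real_normed_vector \<Rightarrow> 'b::euclidean_space"
  shows "open S \<Longrightarrow> open T \<Longrightarrow> g ` S \<subseteq> T \<Longrightarrow> smooth_on S g \<Longrightarrow> smooth_on T f \<Longrightarrow>
    smooth_on S (\<lambda>x. f (g x))"
  by (simp add: smooth_on_def Ck_on_compose)

lemma smooth_on_differentiable: "smooth_on S f \<Longrightarrow> x \<in> S \<Longrightarrow> f differentiable (at x)"
  unfolding smooth_on_def by (metis Ck_on.simps(2))

lemma smooth_on_has_derivative:
  "smooth_on S f \<Longrightarrow> x \<in> S \<Longrightarrow> (f has_derivative frechet_derivative f (at x)) (at x)"
  using smooth_on_differentiable frechet_derivative_works by blast

lemma smooth_on_frechet_derivative:
  "smooth_on S f \<Longrightarrow> smooth_on S (\<lambda>x. frechet_derivative f (at x) v)"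
  unfolding smooth_on_def by (metis Ck_on.simps(2))

lemma smooth_on_imp_continuous_on: "smooth_on S f \<Longrightarrow> continuous_on S f"
  unfolding smooth_on_def using Ck_on_imp_continuous_on by blast

text \<open>\<open>smooth_on_frechet_derivative\<close> covers a fixed direction; expanding the
  field \<xi> in \<open>Basis\<close> reduces to that case.\<close>

lemma smooth_on_frechet_derivative_field:
  fixes f :: "'a::euclidean_space \<Rightarrow> 'b::real_normed_vector"
  assumes "open S" "smooth_on S f" "smooth_on S \<xi>"
  shows "smooth_on S (\<lambda>x. frechet_derivative f (at x) (\<xi> x))"
proof (rule smooth_on_cong)
  show "smooth_on S (\<lambda>x. \<Sum>b\<in>Basis. (\<xi> x \<bullet> b) *\<^sub>R frechet_derivative f (at x) b)"
    by (intro smooth_on_sum smooth_on_scaleR smooth_on_inner smooth_on_const assms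
        smooth_on_frechet_derivative[OF assms(2)])
  fix x assume "x \<in> S"
  then have "linear (frechet_derivative f (at x))"
    using assms by (intro linear_frechet_derivative smooth_on_differentiable)
  then show "(\<Sum>b\<in>Basis. (\<xi> x \<bullet> b) *\<^sub>R frechet_derivative f (at x) b) = frechet_derivative f (at x) (\<xi> x)"
    by (rule linear_expand_Basis[symmetric])
qed (rule assms(1))

text \<open>A direction that moves with the point contributes its own derivative next to the Hessian
  term. For two fields, the Hessian terms cancel by symmetry and the remaining ones form the Lie
  bracket.\<close>

lemma frechet_derivative_frechet_derivative_field:
  fixes f :: "'a::euclidean_space \<Rightarrow> 'b::real_normed_vector"
  assumes "open S" "smooth_on S f" "smooth_on S \<xi>" "x \<in> S"
  shows "frechet_derivative (\<lambda>x. frechet_derivative f (at x) (\<xi> x)) (at x) w =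
    frechet_derivative (\<lambda>y. frechet_derivative f (at y) (\<xi> x)) (at x) w +
    frechet_derivative f (at x) (frechet_derivative \<xi> (at x) w)"
proof -
  let ?D = "\<lambda>b y. frechet_derivative f (at y) b"
  have lin: "linear (frechet_derivative f (at y))" if "y \<in> S" for y
    by (rule linear_frechet_derivative[OF smooth_on_differentiable[OF assms(2) that]])
  have dD: "(?D b has_derivative frechet_derivative (?D b) (at x)) (at x)" for b
    by (rule smooth_on_has_derivative[OF smooth_on_frechet_derivative[OF assms(2)] assms(4)])
  have dx: "((\<lambda>y. \<xi> y \<bullet> b) has_derivative (\<lambda>w. frechet_derivative \<xi> (at x) w \<bullet> b)) (at x)" for b
    by (intro has_derivative_inner_left smooth_on_has_derivative[OF assms(3,4)])
  have "((\<lambda>y. \<Sum>b\<in>Basis. (\<xi> y \<bullet> b) *\<^sub>R ?D b y) has_derivative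
     (\<lambda>w. \<Sum>b\<in>Basis. (\<xi> x \<bullet> b) *\<^sub>R frechet_derivative (?D b) (at x) w +
        (frechet_derivative \<xi> (at x) w \<bullet> b) *\<^sub>R ?D b x)) (at x)"
    by (intro has_derivative_sum has_derivative_scaleR dD dx)
  then have 1: "((\<lambda>y. ?D (\<xi> y) y) has_derivative
     (\<lambda>w. \<Sum>b\<in>Basis. (\<xi> x \<bullet> b) *\<^sub>R frechet_derivative (?D b) (at x) w +
        (frechet_derivative \<xi> (at x) w \<bullet> b) *\<^sub>R ?D b x)) (at x)"
    by (rule has_derivative_transform_within_open[OF _ assms(1,4)])
      (simp add: linear_expand_Basis[OF lin, symmetric])
  have "((\<lambda>y. \<Sum>b\<in>Basis. (\<xi> x \<bullet> b) *\<^sub>R ?D b y) has_derivative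
     (\<lambda>w. \<Sum>b\<in>Basis. (\<xi> x \<bullet> b) *\<^sub>R frechet_derivative (?D b) (at x) w)) (at x)"
    by (intro has_derivative_sum has_derivative_scaleR_right dD)
  then have 2: "((\<lambda>y. ?D (\<xi> x) y) has_derivative
     (\<lambda>w. \<Sum>b\<in>Basis. (\<xi> x \<bullet> b) *\<^sub>R frechet_derivative (?D b) (at x) w)) (at x)"
    by (rule has_derivative_transform_within_open[OF _ assms(1,4)])
      (simp add: linear_expand_Basis[OF lin, symmetric])
  show ?thesis
    by (simp add: frechet_derivative_eqI[OF 1] frechet_derivative_eqI[OF 2] sum.distrib
        linear_expand_Basis[OF lin[OF assms(4)], symmetric])
qed

section \<open>Symmetry of second derivatives\<close>

lemma second_difference_mean_value:
  fixes g :: "'a::euclidean_space \<Rightarrow> real"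
  assumes g: "smooth_on S g" and ball: "cball x (h * (norm a + norm b)) \<subseteq> S" and h: "h > 0"
  obtains y where "dist x y \<le> h * (norm a + norm b)"
    "g (x + h *\<^sub>R a + h *\<^sub>R b) - g (x + h *\<^sub>R a) - g (x + h *\<^sub>R b) + g x =
      h * h * frechet_derivative (\<lambda>y. frechet_derivative g (at y) a) (at y) b"
proof -
  let ?ga = "\<lambda>y. frechet_derivative g (at y) a"
  have near: "dist x (x + s *\<^sub>R a + t *\<^sub>R b) \<le> h * (norm a + norm b)"
    if "0 \<le> s" "s \<le> h" "0 \<le> t" "t \<le> h" for s t
  proof -
    have "norm (s *\<^sub>R a + t *\<^sub>R b) \<le> s * norm a + t * norm b"
      using norm_triangle_ineq[of "s *\<^sub>R a" "t *\<^sub>R b"] that by simp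
    also have "\<dots> \<le> h * norm a + h * norm b"
      using that by (intro add_mono mult_right_mono) auto
    also have "norm (s *\<^sub>R a + t *\<^sub>R b) = dist x (x + s *\<^sub>R a + t *\<^sub>R b)"
      by (metis add.assoc add_diff_cancel_left' dist_commute dist_norm)
    finally show ?thesis by (simp add: distrib_left)
  qed
  then have inS: "x + s *\<^sub>R a + t *\<^sub>R b \<in> S" if "0 \<le> s" "s \<le> h" "0 \<le> t" "t \<le> h" for s t
    using ball that by auto
  have along: "((\<lambda>s. f (y + s *\<^sub>R v)) has_real_derivative frechet_derivative f (at (y + s *\<^sub>R v)) v) (at s)"
    if f: "smooth_on S f" and y: "y + s *\<^sub>R v \<in> S" for f :: "'a \<Rightarrow> real" and y v s
  proof -
    have "((\<lambda>s. y + s *\<^sub>R v) has_derivative (\<lambda>t. t *\<^sub>R v)) (at s)"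
      by (auto intro!: derivative_eq_intros)
    from has_derivative_compose[OF this, of f] smooth_on_has_derivative[OF f y]
    have "((\<lambda>s. f (y + s *\<^sub>R v)) has_derivative
        (\<lambda>t. frechet_derivative f (at (y + s *\<^sub>R v)) (t *\<^sub>R v))) (at s)"
      by blast
    moreover have "(\<lambda>t. frechet_derivative f (at (y + s *\<^sub>R v)) (t *\<^sub>R v)) =
        (*) (frechet_derivative f (at (y + s *\<^sub>R v)) v)"
      using linear_frechet_derivative[OF smooth_on_differentiable[OF f y]]
      by (auto simp: linear_scale)
    ultimately show ?thesis by (simp add: has_field_derivative_def)
  qed
  \<comment> \<open>The second difference is the increment over [0, h] of s |-> g (x + h b + s a) -
    g (x + s a). Applying the mean value theorem to this difference first, and only then in
    direction b to the derivative along a, leads to a single intermediate point.\<close>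
  have "\<exists>s>0. s < h \<and> (g (x + h *\<^sub>R b + h *\<^sub>R a) - g (x + h *\<^sub>R a)) - (g (x + h *\<^sub>R b + 0 *\<^sub>R a) - g (x + 0 *\<^sub>R a))
     = (h - 0) * (?ga (x + h *\<^sub>R b + s *\<^sub>R a) - ?ga (x + s *\<^sub>R a))"
  proof (rule MVT2[OF h])
    fix s :: real assume s: "0 \<le> s" "s \<le> h"
    show "((\<lambda>s. g (x + h *\<^sub>R b + s *\<^sub>R a) - g (x + s *\<^sub>R a)) has_real_derivative
       ?ga (x + h *\<^sub>R b + s *\<^sub>R a) - ?ga (x + s *\<^sub>R a)) (at s)"
      using inS[OF s, of h] inS[OF s, of 0] h s
      by (intro DERIV_diff along[OF g]) (simp_all add: add_ac)
  qed
  then obtain s where s: "0 < s" "s < h" and eq1: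
    "g (x + h *\<^sub>R a + h *\<^sub>R b) - g (x + h *\<^sub>R a) - g (x + h *\<^sub>R b) + g x
      = h * (?ga (x + s *\<^sub>R a + h *\<^sub>R b) - ?ga (x + s *\<^sub>R a))"
    by (auto simp: add_ac algebra_simps)
  have "\<exists>t>0. t < h \<and> ?ga (x + s *\<^sub>R a + h *\<^sub>R b) - ?ga (x + s *\<^sub>R a + 0 *\<^sub>R b)
     = (h - 0) * frechet_derivative ?ga (at (x + s *\<^sub>R a + t *\<^sub>R b)) b"
  proof (rule MVT2[OF h])
    fix t :: real assume t: "0 \<le> t" "t \<le> h"
    show "((\<lambda>t. ?ga (x + s *\<^sub>R a + t *\<^sub>R b)) has_real_derivative
       frechet_derivative ?ga (at (x + s *\<^sub>R a + t *\<^sub>R b)) b) (at t)"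
      using inS[of s t] s t by (intro along smooth_on_frechet_derivative g) auto
  qed
  then obtain t where t: "0 < t" "t < h" and eq2:
    "?ga (x + s *\<^sub>R a + h *\<^sub>R b) - ?ga (x + s *\<^sub>R a) = h * frechet_derivative ?ga (at (x + s *\<^sub>R a + t *\<^sub>R b)) b"
    by auto
  show thesis
    using that[of "x + s *\<^sub>R a + t *\<^sub>R b"] near[of s t] s t eq1 eq2 by simp
qed

text \<open>The second difference is unchanged when a and b are exchanged. It therefore equals h^2
  times either mixed derivative, each taken at some point close to x, and continuity of both at x
  excludes a gap.\<close>

lemma second_derivative_symmetric_real:
  fixes g :: "'a::euclidean_space \<Rightarrow> real"
  assumes S: "open S" "x \<in> S" and g: "smooth_on S g"
  shows "frechet_derivative (\<lambda>y. frechet_derivative g (at y) a) (at x) b =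
    frechet_derivative (\<lambda>y. frechet_derivative g (at y) b) (at x) a"
    (is "?gab x = ?gba x")
proof (rule ccontr)
  assume "?gab x \<noteq> ?gba x"
  define e where "e = \<bar>?gab x - ?gba x\<bar> / 2"
  have e: "e > 0" using \<open>?gab x \<noteq> ?gba x\<close> by (simp add: e_def)
  have cont: "continuous_on S ?gab" "continuous_on S ?gba"
    by (intro smooth_on_imp_continuous_on smooth_on_frechet_derivative g)+
  obtain d1 where d1: "d1 > 0" "\<And>y. dist y x < d1 \<Longrightarrow> dist (?gab y) (?gab x) < e"
    using cont(1) S(2) e continuous_on_interior[of S ?gab x] S(1)
    unfolding continuous_at_eps_delta interior_open[OF S(1)] by blast
  obtain d2 where d2: "d2 > 0" "\<And>y. dist y x < d2 \<Longrightarrow> dist (?gba y) (?gba x) < e"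
    using cont(2) S(2) e continuous_on_interior[of S ?gba x] S(1)
    unfolding continuous_at_eps_delta interior_open[OF S(1)] by blast
  obtain r where r: "r > 0" "cball x r \<subseteq> S" using S open_contains_cball by blast
  \<comment> \<open>The summand 1 keeps k positive when a = b = 0. With the h below, both
    intermediate points lie within half of the smallest of r, d1 and d2 from x.\<close>
  define k where "k = norm a + norm b + 1"
  have k: "k \<ge> 1" by (simp add: k_def)
  define h where "h = min r (min d1 d2) / 2 / k"
  have h: "h > 0" using r d1 d2 k by (simp add: h_def)
  have "h * (norm a + norm b) \<le> h * k" using h by (simp add: k_def)
  also have "h * k = min r (min d1 d2) / 2" using k by (simp add: h_def)
  also have "\<dots> < min r (min d1 d2)"
  proof -
    have "min r (min d1 d2) > 0" using r d1 d2 by simp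
    then show ?thesis by linarith
  qed
  finally have hk: "h * (norm a + norm b) < min r (min d1 d2)" .
  have ball: "cball x (h * (norm a + norm b)) \<subseteq> S" "cball x (h * (norm b + norm a)) \<subseteq> S"
    using hk r by (auto simp: subset_eq add.commute)
  obtain y where y: "dist x y \<le> h * (norm a + norm b)"
    "g (x + h *\<^sub>R a + h *\<^sub>R b) - g (x + h *\<^sub>R a) - g (x + h *\<^sub>R b) + g x = h * h * ?gab y"
    by (rule second_difference_mean_value[OF g ball(1) h])
  obtain z where z: "dist x z \<le> h * (norm b + norm a)"
    "g (x + h *\<^sub>R b + h *\<^sub>R a) - g (x + h *\<^sub>R b) - g (x + h *\<^sub>R a) + g x = h * h * ?gba z"
    by (rule second_difference_mean_value[OF g ball(2) h])
  have "h * h * ?gab y = h * h * ?gba z"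
    using y(2) z(2) by (simp add: add.commute add.left_commute diff_diff_add)
  then have "?gab y = ?gba z" using h by simp
  moreover have "dist (?gab y) (?gab x) < e" "dist (?gba z) (?gba x) < e"
    using d1(2)[of y] d2(2)[of z] y(1) z(1) hk by (auto simp: dist_commute add.commute)
  ultimately have "\<bar>?gab x - ?gba x\<bar> < e + e"
    by (simp add: dist_real_def)
  then show False by (simp add: e_def)
qed

lemma second_derivative_symmetric:
  fixes f :: "'a::euclidean_space \<Rightarrow> 'b::euclidean_space"
  assumes S: "open S" "x \<in> S" and f: "smooth_on S f"
  shows "frechet_derivative (\<lambda>y. frechet_derivative f (at y) a) (at x) b =
    frechet_derivative (\<lambda>y. frechet_derivative f (at y) b) (at x) a"
proof (rule euclidean_eqI)
  fix c :: 'b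
  let ?g = "\<lambda>y. f y \<bullet> c"
  have g: "smooth_on S ?g" by (intro smooth_on_inner S f smooth_on_const)
  have 1: "frechet_derivative ?g (at y) v = frechet_derivative f (at y) v \<bullet> c" if "y \<in> S" for y v
    by (simp add: frechet_derivative_eqI[OF has_derivative_inner_left[OF smooth_on_has_derivative[OF f that]]])
  have 2: "frechet_derivative (\<lambda>y. frechet_derivative ?g (at y) v) (at x) w =
      frechet_derivative (\<lambda>y. frechet_derivative f (at y) v) (at x) w \<bullet> c" for v w
  proof (rule fun_cong[OF frechet_derivative_eqI])
    have "((\<lambda>y. frechet_derivative f (at y) v \<bullet> c) has_derivative
      (\<lambda>w. frechet_derivative (\<lambda>y. frechet_derivative f (at y) v) (at x) w \<bullet> c)) (at x)"
      by (intro has_derivative_inner_left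
          smooth_on_has_derivative[OF smooth_on_frechet_derivative[OF f] S(2)])
    then show "((\<lambda>y. frechet_derivative ?g (at y) v) has_derivative
      (\<lambda>w. frechet_derivative (\<lambda>y. frechet_derivative f (at y) v) (at x) w \<bullet> c)) (at x)"
      by (rule has_derivative_transform_within_open[OF _ S]) (simp add: 1)
  qed
  show "frechet_derivative (\<lambda>y. frechet_derivative f (at y) a) (at x) b \<bullet> c =
    frechet_derivative (\<lambda>y. frechet_derivative f (at y) b) (at x) a \<bullet> c"
    using second_derivative_symmetric_real[OF S g, of a b] by (simp add: 2)
qed

section \<open>Orthonormal frames of immersions\<close>

text \<open>The n orthonormal vectors are independent, hence span the n-dimensional space. The
  remainder of the expansion lies in \<open>T\<close> and is orthogonal to all of them, therefore to
  itself.\<close>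

lemma orthonormal_expansion:
  fixes e :: "nat \<Rightarrow> 'e::euclidean_space"
  assumes T: "subspace T" "dim T = n" and e: "\<And>i. i < n \<Longrightarrow> e i \<in> T"
    and on: "\<And>i j. i < n \<Longrightarrow> j < n \<Longrightarrow> e i \<bullet> e j = (if i = j then 1 else 0)"
    and v: "v \<in> T"
  shows "v = (\<Sum>i<n. (v \<bullet> e i) *\<^sub>R e i)"
proof -
  let ?B = "e ` {..<n}" and ?r = "v - (\<Sum>i<n. (v \<bullet> e i) *\<^sub>R e i)"
  have ne: "e i \<noteq> e j" if "i < n" "j < n" "i \<noteq> j" for i j
    using on[OF that(1,2)] on[OF that(1,1)] that by auto
  then have "card ?B = n"
    by (subst card_image) (auto simp: inj_on_def)
  moreover have "independent ?B"
  proof (rule pairwise_orthogonal_independent)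
    show "pairwise orthogonal ?B"
      using on by (auto simp: pairwise_def orthogonal_def)
    show "0 \<notin> ?B" using on by (metis imageE inner_zero_left lessThan_iff zero_neq_one)
  qed
  ultimately have span: "T \<subseteq> span ?B"
    using e T(2) by (intro card_ge_dim_independent) auto
  have "?r \<in> T"
    using T(1) v e by (intro subspace_diff subspace_sum subspace_scale) auto
  moreover have "orthogonal ?r b" if "b \<in> ?B" for b
  proof -
    obtain j where j: "j < n" "b = e j" using \<open>b \<in> ?B\<close> by auto
    have "(\<Sum>i<n. (v \<bullet> e i) * (e i \<bullet> e j)) = (\<Sum>i<n. if i = j then v \<bullet> e j else 0)"
      using on[OF _ j(1)] by (intro sum.cong) auto
    then show ?thesis
      using j by (simp add: orthogonal_def inner_diff_left inner_sum_left)
  qed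
  ultimately have "orthogonal ?r ?r"
    using span orthogonal_to_span by blast
  then show ?thesis by (simp add: orthogonal_self)
qed

text \<open>Gram--Schmidt, adding one vector at a time; the open set shrinks so that the new vector, chosen
  transversal to the others at \<open>u0\<close>, stays nonzero after projection.\<close>

lemma immersion_orthonormal_frame_aux:
  fixes F :: "'m::euclidean_space \<Rightarrow> 'e::euclidean_space"
  assumes V: "open V" "u0 \<in> V" and F: "smooth_on V F"
    and inj: "\<And>u. u \<in> V \<Longrightarrow> inj (frechet_derivative F (at u))"
    and k: "k \<le> DIM('m)"
  shows "\<exists>W \<xi>. open W \<and> u0 \<in> W \<and> W \<subseteq> V \<and> (\<forall>i<k. smooth_on W (\<xi> i)) \<and>
    (\<forall>u\<in>W. \<forall>i<k. \<forall>j<k. frechet_derivative F (at u) (\<xi> i u) \<bullet> frechet_derivative F (at u) (\<xi> j u) =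
      (if i = j then 1 else 0))"
  using k
proof (induction k)
  case 0
  then show ?case using V by auto
next
  case (Suc k)
  let ?D = "\<lambda>u. frechet_derivative F (at u)"
  obtain W \<xi> where W: "open W" "u0 \<in> W" "W \<subseteq> V" and sm: "\<And>i. i < k \<Longrightarrow> smooth_on W (\<xi> i)"
    and on: "\<And>u i j. u \<in> W \<Longrightarrow> i < k \<Longrightarrow> j < k \<Longrightarrow>
      ?D u (\<xi> i u) \<bullet> ?D u (\<xi> j u) = (if i = j then 1 else 0)"
    using Suc.IH Suc.prems by (metis Suc_leD)
  have lin: "linear (?D u)" if "u \<in> W" for u
    using that W by (intro linear_frechet_derivative smooth_on_differentiable[OF F]) auto
  have FW: "smooth_on W F" by (rule smooth_on_subset[OF F W(3)])
  have "dim ((\<lambda>i. \<xi> i u0) ` {..<k}) \<le> card ((\<lambda>i. \<xi> i u0) ` {..<k})"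
    by (intro dim_le_card' finite_imageI) auto
  also have "\<dots> \<le> k" using card_image_le[of "{..<k}" "\<lambda>i. \<xi> i u0"] by simp
  finally have "dim (span ((\<lambda>i. \<xi> i u0) ` {..<k})) < DIM('m)"
    using Suc.prems by simp
  then have "span ((\<lambda>i. \<xi> i u0) ` {..<k}) \<noteq> UNIV" using dim_UNIV by (metis less_irrefl)
  then obtain w where w: "w \<notin> span ((\<lambda>i. \<xi> i u0) ` {..<k})" by auto
  \<comment> \<open>Orthogonality concerns images under the derivative of F, but the correction is
    made in the parameter space: \<open>?D u (\<eta> u)\<close> is the Gram-Schmidt residual, while
    \<eta> remains a coordinate field.\<close>
  define \<eta> where "\<eta> u = w - (\<Sum>i<k. (?D u w \<bullet> ?D u (\<xi> i u)) *\<^sub>R \<xi> i u)" for u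
  have sm_D: "smooth_on W (\<lambda>u. ?D u (\<zeta> u))" if "smooth_on W \<zeta>" for \<zeta>
    by (rule smooth_on_frechet_derivative_field[OF W(1) FW that])
  have sm_\<eta>: "smooth_on W \<eta>"
    unfolding \<eta>_def
    by (intro smooth_on_diff smooth_on_sum smooth_on_scaleR smooth_on_inner smooth_on_const W(1) sm sm_D)
      auto
  have \<eta>0: "\<eta> u0 \<noteq> 0"
  proof
    assume "\<eta> u0 = 0"
    then have "w = (\<Sum>i<k. (?D u0 w \<bullet> ?D u0 (\<xi> i u0)) *\<^sub>R \<xi> i u0)" by (simp add: \<eta>_def)
    also have "\<dots> \<in> span ((\<lambda>i. \<xi> i u0) ` {..<k})"
      by (intro span_sum span_scale span_base) auto
    finally show False using w by simp
  qed
  have orth: "?D u (\<eta> u) \<bullet> ?D u (\<xi> j u) = 0" if u: "u \<in> W" and j: "j < k" for u j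
  proof -
    have "?D u (\<eta> u) = ?D u w - (\<Sum>i<k. (?D u w \<bullet> ?D u (\<xi> i u)) *\<^sub>R ?D u (\<xi> i u))"
      using lin[OF u] by (simp add: \<eta>_def linear_diff linear_sum linear_scale)
    moreover have "(\<Sum>i<k. (?D u w \<bullet> ?D u (\<xi> i u)) * (?D u (\<xi> i u) \<bullet> ?D u (\<xi> j u))) =
        (\<Sum>i<k. if i = j then ?D u w \<bullet> ?D u (\<xi> j u) else 0)"
      using on[OF u _ j] by (intro sum.cong) auto
    ultimately show ?thesis
      using j by (simp add: inner_diff_left inner_sum_left)
  qed
  define c where "c u = ?D u (\<eta> u) \<bullet> ?D u (\<eta> u)" for u
  define W' where "W' = W \<inter> c -` {0<..}"
  have sm_c: "smooth_on W c"
    unfolding c_def by (intro smooth_on_inner W(1) sm_D sm_\<eta>)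
  have W': "open W'"
    unfolding W'_def
    by (intro continuous_open_preimage smooth_on_imp_continuous_on[OF sm_c] W(1)) simp
  have u0: "u0 \<in> W'"
  proof -
    have "?D u0 (\<eta> u0) \<noteq> 0"
      using \<eta>0 injD[OF inj[OF V(2)], of "\<eta> u0" 0] linear_0[OF lin[OF W(2)]] by auto
    then show ?thesis using W by (simp add: W'_def c_def)
  qed
  \<comment> \<open>\<open>c\<close> is the squared length of the residual, so the exponent -1/2
    normalizes it; on \<open>W'\<close> the base of the power is positive.\<close>
  define \<zeta> where "\<zeta> i = (if i = k then (\<lambda>u. c u powr (-1/2) *\<^sub>R \<eta> u) else \<xi> i)" for i
  have sub: "W' \<subseteq> W" by (auto simp: W'_def)
  have "smooth_on W' (\<lambda>u. c u powr (-1/2))"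
    using smooth_on_subset[OF sm_c sub] Ck_on_powr[OF W', of c] by (simp add: smooth_on_def W'_def)
  then have "smooth_on W' (\<lambda>u. c u powr (-1/2) *\<^sub>R \<eta> u)"
    by (rule smooth_on_scaleR[OF W' _ smooth_on_subset[OF sm_\<eta> sub]])
  then have "smooth_on W' (\<zeta> i)" if "i < Suc k" for i
    using that smooth_on_subset[OF sm[of i] sub] by (auto simp: \<zeta>_def less_Suc_eq)
  moreover have "?D u (\<zeta> i u) \<bullet> ?D u (\<zeta> j u) = (if i = j then 1 else 0)"
    if u: "u \<in> W'" and ij: "i < Suc k" "j < Suc k" for u i j
  proof -
    have uW: "u \<in> W" and cu: "c u > 0" using u by (auto simp: W'_def)
    have Dk: "?D u (\<zeta> k u) = c u powr (-1/2) *\<^sub>R ?D u (\<eta> u)"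
      using lin[OF uW] by (simp add: \<zeta>_def linear_scale)
    have "c u powr (-1/2) * (c u powr (-1/2) * c u) = 1"
    proof -
      have "c u powr (-1/2) * (c u powr (-1/2) * c u powr 1) = c u powr (-1/2 + (-1/2 + 1))"
        by (simp only: powr_add)
      then show ?thesis using cu by simp
    qed
    then have kk: "?D u (\<zeta> k u) \<bullet> ?D u (\<zeta> k u) = 1"
      unfolding Dk by (simp add: c_def)
    have ki: "?D u (\<zeta> k u) \<bullet> ?D u (\<zeta> i u) = 0" if "i < k" for i
      using that orth[OF uW that] unfolding Dk by (simp add: \<zeta>_def)
    consider "i < k" "j < k" | "i = k" "j = k" | "i = k" "j < k" | "i < k" "j = k"
      using ij by linarith
    then show ?thesis
    proof cases
      case 1
      then show ?thesis using on[OF uW, of i j] by (simp add: \<zeta>_def)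
    next
      case 4
      then show ?thesis using ki[of i] by (simp add: inner_commute)
    qed (use kk ki in simp_all)
  qed
  ultimately show ?case
    using W' u0 sub W(3) by (intro exI[of _ W'] exI[of _ \<zeta>]) auto
qed

lemma immersion_orthonormal_frame:
  fixes F :: "'m::euclidean_space \<Rightarrow> 'e::euclidean_space"
  assumes "open V" "u0 \<in> V" "smooth_on V F"
    and "\<And>u. u \<in> V \<Longrightarrow> inj (frechet_derivative F (at u))"
  obtains W \<xi> where "open W" "u0 \<in> W" "W \<subseteq> V" "\<And>i. i < DIM('m) \<Longrightarrow> smooth_on W (\<xi> i)"
    "\<And>u i j. u \<in> W \<Longrightarrow> i < DIM('m) \<Longrightarrow> j < DIM('m) \<Longrightarrow>
      frechet_derivative F (at u) (\<xi> i u) \<bullet> frechet_derivative F (at u) (\<xi> j u) =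
        (if i = j then 1 else 0)"
  using immersion_orthonormal_frame_aux[OF assms order_refl] that by metis

section \<open>Orthogonal projections and the curvature of the sphere\<close>

lemma orth_proj_eqI:
  assumes "subspace T" "t \<in> T" "\<And>w. w \<in> T \<Longrightarrow> (v - t) \<bullet> w = 0"
  shows "orth_proj T v = t"
  unfolding orth_proj_def
proof (rule the_equality)
  fix s assume s: "s \<in> T \<and> (\<forall>w\<in>T. (v - s) \<bullet> w = 0)"
  have "t - s \<in> T" using s assms by (simp add: subspace_diff)
  then have "(v - s) \<bullet> (t - s) = 0" "(v - t) \<bullet> (t - s) = 0" using s assms by auto
  then have "(t - s) \<bullet> (t - s) = 0" by (simp add: inner_diff_left)
  then show "s = t" by simp
qed (use assms in auto)

lemma subspace_sphere_tangent: "subspace (sphere_tangent y)"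
  by (auto simp: subspace_def sphere_tangent_def inner_add_left)

lemma orth_proj_sphere_tangent:
  assumes "norm y = 1"
  shows "orth_proj (sphere_tangent y) v = v - (v \<bullet> y) *\<^sub>R y"
proof -
  have "y \<bullet> y = 1" using assms by (simp add: dot_square_norm)
  then show ?thesis
    by (intro orth_proj_eqI subspace_sphere_tangent)
      (auto simp: sphere_tangent_def inner_diff_left inner_diff_right inner_commute)
qed

text \<open>Composition with \<open>sgn\<close> sees F on the sphere only, so F may be replaced by
  any extension G differentiable at y. The derivative of \<open>sgn\<close> at a unit vector y is
  the projection along y onto its orthogonal complement.\<close>

lemma sphere_deriv_eqI:
  assumes y: "norm y = 1" and FG: "\<And>q. norm q = 1 \<Longrightarrow> F q = G q"
    and G: "(G has_derivative G') (at y)"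
  shows "sphere_deriv F y v = G' (v - (v \<bullet> y) *\<^sub>R y)"
proof -
  have y0: "y \<noteq> 0" and yy: "sgn y = y" using y by (auto simp: sgn_div_norm)
  have "((\<lambda>z. inverse (norm z) *\<^sub>R z) has_derivative (\<lambda>v. v - (v \<bullet> y) *\<^sub>R y)) (at y)"
    using y0 yy y has_derivative_norm[OF y0]
    by (auto intro!: derivative_eq_intros)
  then have "(sgn has_derivative (\<lambda>v. v - (v \<bullet> y) *\<^sub>R y)) (at y)"
    by (simp add: sgn_div_norm[abs_def])
  from has_derivative_compose[OF this, of G G'] G yy
  have "((\<lambda>z. G (sgn z)) has_derivative (\<lambda>v. G' (v - (v \<bullet> y) *\<^sub>R y))) (at y)" by simp
  then have "((\<lambda>z. F (sgn z)) has_derivative (\<lambda>v. G' (v - (v \<bullet> y) *\<^sub>R y))) (at y)"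
    by (rule has_derivative_transform_within_open[of _ _ _ _ "- {0}"])
      (use y0 in \<open>auto simp: FG norm_sgn\<close>)
  then show ?thesis by (simp add: sphere_deriv_def frechet_derivative_eqI)
qed

lemma sphere_deriv_projected_constant:
  assumes "norm q = 1" "v \<bullet> q = 0"
  shows "sphere_deriv (\<lambda>q. orth_proj (sphere_tangent q) c) q v = - (c \<bullet> v) *\<^sub>R q - (c \<bullet> q) *\<^sub>R v"
proof -
  have "((\<lambda>q. c - (c \<bullet> q) *\<^sub>R q) has_derivative (\<lambda>v. - (c \<bullet> v) *\<^sub>R q - (c \<bullet> q) *\<^sub>R v)) (at q)"
    by (auto intro!: derivative_eq_intros simp: algebra_simps)
  from sphere_deriv_eqI[OF assms(1) _ this, of "\<lambda>q. orth_proj (sphere_tangent q) c" v]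
  show ?thesis using assms(2) by (simp add: orth_proj_sphere_tangent)
qed

text \<open>The derivative of the projected constant c consists of a multiple of q, which the
  tangential projection removes, and a multiple of the direction of differentiation.\<close>

lemma sphere_conn_projected_constants:
  assumes "norm q = 1"
  shows "sphere_conn (\<lambda>q. orth_proj (sphere_tangent q) b) (\<lambda>q. orth_proj (sphere_tangent q) c) q =
    - (c \<bullet> q) *\<^sub>R (b - (b \<bullet> q) *\<^sub>R q)"
proof -
  have qq: "q \<bullet> q = 1" using assms by (simp add: dot_square_norm)
  show ?thesis
    unfolding sphere_conn_def
    by (subst sphere_deriv_projected_constant)
      (use assms qq in \<open>simp_all add: orth_proj_sphere_tangent algebra_simps inner_diff_left inner_add_left\<close>)
qed

text \<open>The sphere has constant curvature 1. The fields extending a and b have zero bracket at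
  y, because the derivative of either along the other is the same vector -(a . b) y; only the two
  iterated covariant derivatives contribute.\<close>

lemma sphere_curvature:
  assumes y: "norm y = 1" and "a \<bullet> y = 0" "b \<bullet> y = 0" "c \<bullet> y = 0"
  shows "sphere_curvature y a b c = (b \<bullet> c) *\<^sub>R a - (a \<bullet> c) *\<^sub>R b"
proof -
  let ?P = "\<lambda>a q. orth_proj (sphere_tangent q) a"
  have P: "?P a y = a" "?P b y = b" using assms by (simp_all add: orth_proj_sphere_tangent)
  have bracket: "sphere_bracket (?P a) (?P b) y = 0"
    using assms by (simp add: sphere_bracket_def P sphere_deriv_projected_constant inner_commute)
  have second: "sphere_conn (?P v) (sphere_conn (?P w) (?P c)) y = - (c \<bullet> v) *\<^sub>R w"
    if v: "v \<bullet> y = 0" and w: "w \<bullet> y = 0" for v w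
  proof -
    \<comment> \<open>On the sphere the inner covariant derivative has the polynomial form found
      above; this polynomial is the extension that \<open>sphere_deriv_eqI\<close> asks for.\<close>
    have "((\<lambda>q. - (c \<bullet> q) *\<^sub>R (w - (w \<bullet> q) *\<^sub>R q)) has_derivative
       (\<lambda>x. - (c \<bullet> x) *\<^sub>R (w - (w \<bullet> y) *\<^sub>R y) - (c \<bullet> y) *\<^sub>R (- (w \<bullet> x) *\<^sub>R y - (w \<bullet> y) *\<^sub>R x))) (at y)"
      by (auto intro!: derivative_eq_intros simp: algebra_simps)
    from sphere_deriv_eqI[OF y sphere_conn_projected_constants this, of v]
    show ?thesis
      using assms v w by (simp add: sphere_conn_def[of "?P v"] orth_proj_sphere_tangent)
  qed
  have "sphere_conn (sphere_bracket (?P a) (?P b)) (?P c) y = 0"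
    using y assms by (simp add: sphere_conn_def bracket sphere_deriv_projected_constant orth_proj_sphere_tangent)
  then show ?thesis
    using assms by (simp add: sphere_curvature_def sphere_curvature_field_def second inner_commute)
qed

section \<open>Derivatives of functions on an immersed submanifold\<close>

locale sphere_immersion =
  fixes M :: "('a, 'm::euclidean_space, 'e::euclidean_space) mapped_manifold"
  assumes submanifold: "sphere_submanifold M"
begin

section \<open>Charts and differentiability in charts\<close>

lemma manifold: "smooth_manifold M"
  using submanifold by (simp add: sphere_submanifold_def)

lemma chart_open: "(V, x) \<in> atlas M \<Longrightarrow> open V"
  using manifold by (auto simp: smooth_manifold_def)

lemma chart_homeomorphic:
  "(V, x) \<in> atlas M \<Longrightarrow> homeomorphic_map (top_of_set V) (subtopology (mtop M) (x ` V)) x"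
  using manifold by (auto simp: smooth_manifold_def)

lemma chart_range_open: "(V, x) \<in> atlas M \<Longrightarrow> openin (mtop M) (x ` V)"
  using manifold by (auto simp: smooth_manifold_def)

lemma chart_inj_on: "(V, x) \<in> atlas M \<Longrightarrow> inj_on x V"
  using homeomorphic_imp_injective_map[OF chart_homeomorphic] by simp

lemma chart_in_topspace: "(V, x) \<in> atlas M \<Longrightarrow> u \<in> V \<Longrightarrow> x u \<in> topspace (mtop M)"
  using openin_subset[OF chart_range_open] by blast

lemma chart_around:
  assumes "p \<in> topspace (mtop M)"
  obtains V x u where "(V, x) \<in> atlas M" "u \<in> V" "p = x u"
  using assms manifold by (fastforce simp: smooth_manifold_def)

lemma chart_preimage_open:
  assumes "(V, x) \<in> atlas M" "openin (mtop M) U"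
  shows "open {u \<in> V. x u \<in> U}"
proof -
  have "continuous_map (top_of_set V) (mtop M) x"
    using homeomorphic_imp_continuous_map[OF chart_homeomorphic[OF assms(1)]]
    by (simp add: continuous_map_in_subtopology)
  then have "openin (top_of_set V) {u \<in> V. x u \<in> U}"
    using assms(2) by (auto simp: continuous_map_def)
  then show ?thesis
    using chart_open[OF assms(1)] by (simp add: openin_open_eq)
qed

lemma chart_image_open:
  assumes "(V, x) \<in> atlas M" "open W" "W \<subseteq> V"
  shows "openin (mtop M) (x ` W)"
proof -
  have "openin (subtopology (mtop M) (x ` V)) (x ` W)"
    using homeomorphic_imp_open_map[OF chart_homeomorphic[OF assms(1)]] assms chart_open[OF assms(1)]
    by (simp add: open_map_def openin_open_eq)
  then show ?thesis
    using chart_range_open[OF assms(1)] openin_trans_full by blast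
qed

lemma imm_smooth: "smooth_fun_on M (topspace (mtop M)) (imm M)"
  using submanifold by (simp add: sphere_submanifold_def)

lemma imm_chart_smooth: "(V, x) \<in> atlas M \<Longrightarrow> smooth_on V (\<lambda>u. imm M (x u))"
  using imm_smooth chart_in_topspace unfolding smooth_fun_on_def
  by (fastforce elim!: smooth_on_subset)

lemma imm_deriv_inj: "(V, x) \<in> atlas M \<Longrightarrow> u \<in> V \<Longrightarrow> inj (frechet_derivative (\<lambda>u. imm M (x u)) (at u))"
  using submanifold by (auto simp: sphere_submanifold_def)

lemma imm_deriv_linear: "(V, x) \<in> atlas M \<Longrightarrow> u \<in> V \<Longrightarrow> linear (frechet_derivative (\<lambda>u. imm M (x u)) (at u))"
  by (intro linear_frechet_derivative smooth_on_differentiable[OF imm_chart_smooth])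

lemma norm_imm: "p \<in> topspace (mtop M) \<Longrightarrow> norm (imm M p) = 1"
  using submanifold by (force simp: sphere_submanifold_def)

lemma transition:
  assumes "(V, x) \<in> atlas M" "(W, y) \<in> atlas M"
  defines "S \<equiv> {u \<in> V. x u \<in> y ` W}" and "\<psi> \<equiv> \<lambda>u. inv_into W y (x u)"
  shows "open S" "smooth_on S \<psi>" "u \<in> S \<Longrightarrow> \<psi> u \<in> W" "u \<in> S \<Longrightarrow> y (\<psi> u) = x u"
proof -
  show "open S" unfolding S_def by (intro chart_preimage_open assms chart_range_open)
  show "smooth_on S \<psi>"
    using manifold assms by (fastforce simp: smooth_manifold_def)
  show "u \<in> S \<Longrightarrow> \<psi> u \<in> W" "u \<in> S \<Longrightarrow> y (\<psi> u) = x u"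
    by (auto simp: S_def \<psi>_def inv_into_into f_inv_into_f)
qed

text \<open>Near u the map f \<circ> x is f \<circ> y composed with the transition map, so this is
  the chain rule. Chart independence of tangent spaces (f the immersion) and of
  \<open>mderiv\<close> (f arbitrary) both come from it.\<close>

lemma chart_change:
  assumes x: "(V, x) \<in> atlas M" "u \<in> V" and y: "(W, y) \<in> atlas M" "v \<in> W" and xy: "x u = y v"
    and f: "(\<lambda>v. f (y v)) differentiable (at v)"
  shows "((\<lambda>u. f (x u)) has_derivative (\<lambda>w. frechet_derivative (\<lambda>v. f (y v)) (at v)
    (frechet_derivative (\<lambda>u. inv_into W y (x u)) (at u) w))) (at u)"
proof -
  let ?S = "{u \<in> V. x u \<in> y ` W}" and ?\<psi> = "\<lambda>u. inv_into W y (x u)"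
  have u: "u \<in> ?S" using x y xy by auto
  have v: "?\<psi> u = v" using chart_inj_on[OF y(1)] y(2) xy by simp
  have "(?\<psi> has_derivative frechet_derivative ?\<psi> (at u)) (at u)"
    by (rule smooth_on_has_derivative[OF transition(2)[OF x(1) y(1)] u])
  moreover have "((\<lambda>v. f (y v)) has_derivative frechet_derivative (\<lambda>v. f (y v)) (at v)) (at (?\<psi> u))"
    using f by (simp only: v frechet_derivative_works)
  ultimately have "((\<lambda>u. f (y (?\<psi> u))) has_derivative (\<lambda>w. frechet_derivative (\<lambda>v. f (y v)) (at v)
    (frechet_derivative ?\<psi> (at u) w))) (at u)"
    by (rule has_derivative_compose)
  then show ?thesis
    by (rule has_derivative_transform_within_open[OF _ transition(1)[OF x(1) y(1)] u])
      (use transition(4)[OF x(1) y(1)] in simp)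
qed

text \<open>One chart suffices because transition maps are smooth. This existential form is
  convenient to establish; \<open>mdiffD\<close> gives the form for every chart that the rules for
  \<open>mderiv\<close> use.\<close>

definition mdiff :: "('a \<Rightarrow> 'b::real_normed_vector) \<Rightarrow> 'a \<Rightarrow> bool" where
  "mdiff f p \<longleftrightarrow> (\<exists>(V, x)\<in>atlas M. \<exists>u\<in>V. x u = p \<and> (\<lambda>u. f (x u)) differentiable (at u))"

lemma mdiffI: "(V, x) \<in> atlas M \<Longrightarrow> u \<in> V \<Longrightarrow> (\<lambda>u. f (x u)) differentiable (at u) \<Longrightarrow> mdiff f (x u)"
  by (auto simp: mdiff_def)

lemma mdiffD:
  assumes "(V, x) \<in> atlas M" "u \<in> V" "mdiff f (x u)"
  shows "(\<lambda>u. f (x u)) differentiable (at u)"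
proof -
  obtain W y v where "(W, y) \<in> atlas M" "v \<in> W" "y v = x u" "(\<lambda>v. f (y v)) differentiable (at v)"
    using assms(3) unfolding mdiff_def by blast
  then show ?thesis
    using chart_change[OF assms(1,2), of W y v f] unfolding differentiable_def by metis
qed

lemma mdiffE:
  assumes "mdiff f p"
  obtains V x u where "(V, x) \<in> atlas M" "u \<in> V" "p = x u"
    "((\<lambda>u. f (x u)) has_derivative frechet_derivative (\<lambda>u. f (x u)) (at u)) (at u)"
  using assms that unfolding mdiff_def frechet_derivative_works by blast

lemma mdiff_topspace: "mdiff f p \<Longrightarrow> p \<in> topspace (mtop M)"
  by (auto elim!: mdiffE chart_in_topspace)

section \<open>Tangent spaces and the differential of a function\<close>

lemma tangent_space_chart:
  assumes "(V, x) \<in> atlas M" "u \<in> V"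
  shows "tangent_space M (x u) = range (frechet_derivative (\<lambda>u. imm M (x u)) (at u))"
proof
  show "tangent_space M (x u) \<subseteq> range (frechet_derivative (\<lambda>u. imm M (x u)) (at u))"
  proof
    fix t assume "t \<in> tangent_space M (x u)"
    then obtain W y v w where y: "(W, y) \<in> atlas M" "v \<in> W" "y v = x u"
      and t: "t = frechet_derivative (\<lambda>v. imm M (y v)) (at v) w"
      unfolding tangent_space_def by blast
    have "frechet_derivative (\<lambda>v. imm M (y v)) (at v) =
      (\<lambda>w. frechet_derivative (\<lambda>u. imm M (x u)) (at u) (frechet_derivative (\<lambda>v. inv_into V x (y v)) (at v) w))"
      by (rule frechet_derivative_eqI[OF chart_change[OF y(1,2) assms y(3)]])
        (rule smooth_on_differentiable[OF imm_chart_smooth[OF assms(1)] assms(2)])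
    then show "t \<in> range (frechet_derivative (\<lambda>u. imm M (x u)) (at u))"
      by (simp add: t)
  qed
qed (use assms in \<open>auto simp: tangent_space_def\<close>)

text \<open>Well-definedness of the \<open>THE\<close> in \<open>mderiv\<close>. If another chart
  represents the same tangent vector, injectivity of the differential of the immersion forces the
  derivative of the transition map to carry one coordinate vector to the other, and then f has the
  same derivative in both charts.\<close>

lemma mderiv_chart:
  assumes x: "(V, x) \<in> atlas M" "u \<in> V" and f: "mdiff f (x u)"
  shows "mderiv M f (x u) (frechet_derivative (\<lambda>u. imm M (x u)) (at u) w) =
    frechet_derivative (\<lambda>u. f (x u)) (at u) w"
  unfolding mderiv_def
proof (rule the_equality)
  fix d
  assume "\<exists>(W, y)\<in>atlas M. \<exists>v\<in>W. \<exists>w'. y v = x u \<and>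
    frechet_derivative (\<lambda>u. imm M (y u)) (at v) w' = frechet_derivative (\<lambda>u. imm M (x u)) (at u) w \<and>
    frechet_derivative (\<lambda>u. f (y u)) (at v) w' = d"
  then obtain W y v w' where y: "(W, y) \<in> atlas M" "v \<in> W" "y v = x u"
    and w': "frechet_derivative (\<lambda>u. imm M (y u)) (at v) w' = frechet_derivative (\<lambda>u. imm M (x u)) (at u) w"
    and d: "frechet_derivative (\<lambda>u. f (y u)) (at v) w' = d" by blast
  let ?L = "frechet_derivative (\<lambda>v. inv_into V x (y v)) (at v)"
  have "frechet_derivative (\<lambda>v. imm M (y v)) (at v) =
    (\<lambda>w. frechet_derivative (\<lambda>u. imm M (x u)) (at u) (?L w))"
    by (rule frechet_derivative_eqI[OF chart_change[OF y(1,2) x y(3)]])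
      (rule smooth_on_differentiable[OF imm_chart_smooth[OF x(1)] x(2)])
  then have "?L w' = w"
    using w' imm_deriv_inj[OF x] by (simp add: inj_eq)
  moreover have "frechet_derivative (\<lambda>v. f (y v)) (at v) =
    (\<lambda>w. frechet_derivative (\<lambda>u. f (x u)) (at u) (?L w))"
    by (rule frechet_derivative_eqI[OF chart_change[OF y(1,2) x y(3) mdiffD[OF x f]]])
  ultimately show "d = frechet_derivative (\<lambda>u. f (x u)) (at u) w"
    using d by simp
qed (use x in blast)

lemma mderiv_chart_eqI:
  assumes "(V, x) \<in> atlas M" "u \<in> V" "((\<lambda>u. f (x u)) has_derivative f') (at u)"
  shows "mderiv M f (x u) (frechet_derivative (\<lambda>u. imm M (x u)) (at u) w) = f' w"
  using mderiv_chart[OF assms(1,2) mdiffI[OF assms(1,2)], of f w] assms(3) frechet_derivative_eqI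
  by (metis differentiable_def)

lemma tangent_vectorE:
  assumes "v \<in> tangent_space M p" "mdiff f p"
  obtains V x u w where "(V, x) \<in> atlas M" "u \<in> V" "p = x u"
    "v = frechet_derivative (\<lambda>u. imm M (x u)) (at u) w"
    "((\<lambda>u. f (x u)) has_derivative frechet_derivative (\<lambda>u. f (x u)) (at u)) (at u)"
    "mderiv M f p v = frechet_derivative (\<lambda>u. f (x u)) (at u) w"
proof -
  obtain V x u where x: "(V, x) \<in> atlas M" "u \<in> V" "p = x u"
    and f: "((\<lambda>u. f (x u)) has_derivative frechet_derivative (\<lambda>u. f (x u)) (at u)) (at u)"
    using assms(2) by (rule mdiffE)
  obtain w where w: "v = frechet_derivative (\<lambda>u. imm M (x u)) (at u) w"
    using assms(1) x tangent_space_chart by auto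
  show thesis
    using that[OF x w f] mderiv_chart[OF x(1,2), of f w] assms(2) x(3) w by simp
qed

lemma subspace_tangent_space: "p \<in> topspace (mtop M) \<Longrightarrow> subspace (tangent_space M p)"
  by (auto elim!: chart_around simp: tangent_space_chart intro!: linear_subspace_image imm_deriv_linear)

lemma dim_tangent_space: "p \<in> topspace (mtop M) \<Longrightarrow> dim (tangent_space M p) = DIM('m)"
  by (auto elim!: chart_around simp: tangent_space_chart imm_deriv_linear imm_deriv_inj dim_image_eq)

text \<open>The squared norm of the immersion is the constant 1, and its derivative in a chart is
  twice the inner product in question.\<close>

lemma tangent_orthogonal_imm:
  assumes "p \<in> topspace (mtop M)" "v \<in> tangent_space M p"
  shows "v \<bullet> imm M p = 0"
proof -
  obtain V x u where x: "(V, x) \<in> atlas M" "u \<in> V" "p = x u"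
    using chart_around[OF assms(1)] .
  let ?F = "\<lambda>u. imm M (x u)"
  obtain w where w: "v = frechet_derivative ?F (at u) w"
    using assms(2) x tangent_space_chart by auto
  have d: "(?F has_derivative frechet_derivative ?F (at u)) (at u)"
    by (rule smooth_on_has_derivative[OF imm_chart_smooth[OF x(1)] x(2)])
  have "((\<lambda>u. ?F u \<bullet> ?F u) has_derivative
      (\<lambda>w. ?F u \<bullet> frechet_derivative ?F (at u) w + frechet_derivative ?F (at u) w \<bullet> ?F u)) (at u)"
    by (rule has_derivative_inner[OF d d])
  then have 1: "((\<lambda>u. 1) has_derivative
      (\<lambda>w. ?F u \<bullet> frechet_derivative ?F (at u) w + frechet_derivative ?F (at u) w \<bullet> ?F u)) (at u)"
    by (rule has_derivative_transform_within_open[OF _ chart_open[OF x(1)] x(2)])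
      (simp add: dot_square_norm norm_imm chart_in_topspace[OF x(1)])
  have "(\<lambda>w. ?F u \<bullet> frechet_derivative ?F (at u) w + frechet_derivative ?F (at u) w \<bullet> ?F u) = (\<lambda>w. 0)"
    by (rule has_derivative_unique[OF 1 has_derivative_const])
  then have "?F u \<bullet> frechet_derivative ?F (at u) w + frechet_derivative ?F (at u) w \<bullet> ?F u = 0"
    by meson
  then show ?thesis by (simp add: w x(3) inner_commute)
qed

section \<open>Rules of differentiation on the submanifold\<close>

lemma mdiff_const: "p \<in> topspace (mtop M) \<Longrightarrow> mdiff (\<lambda>q. c) p"
  by (auto elim!: chart_around intro!: mdiffI)

lemma mdiff_imm: "p \<in> topspace (mtop M) \<Longrightarrow> mdiff (imm M) p"
  by (auto elim!: chart_around intro!: mdiffI smooth_on_differentiable[OF imm_chart_smooth])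

lemma mderiv_imm:
  assumes "p \<in> topspace (mtop M)" "v \<in> tangent_space M p"
  shows "mderiv M (imm M) p v = v"
  by (rule tangent_vectorE[OF assms(2) mdiff_imm[OF assms(1)]]) simp

lemma mderiv_const:
  assumes "p \<in> topspace (mtop M)" "v \<in> tangent_space M p"
  shows "mderiv M (\<lambda>q. c) p v = 0"
  by (rule tangent_vectorE[OF assms(2) mdiff_const[OF assms(1), of c]]) simp

text \<open>Tangency is essential: off the tangent space there is no coordinate vector and
  \<open>mderiv\<close> is unspecified. Linearity comes from reading both vectors in one
  chart.\<close>

lemma mderiv_add_vector:
  assumes "v \<in> tangent_space M p" "w \<in> tangent_space M p" "mdiff f p"
  shows "mderiv M f p (v + w) = mderiv M f p v + mderiv M f p w"
proof -
  obtain V x u where x: "(V, x) \<in> atlas M" "u \<in> V" "p = x u"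
    using mdiffE[OF assms(3)] by metis
  obtain v' w' where v': "v = frechet_derivative (\<lambda>u. imm M (x u)) (at u) v'"
    and w': "w = frechet_derivative (\<lambda>u. imm M (x u)) (at u) w'"
    using assms(1,2) tangent_space_chart[OF x(1,2)] x(3) by auto
  have "v + w = frechet_derivative (\<lambda>u. imm M (x u)) (at u) (v' + w')"
    by (simp add: v' w' linear_add[OF imm_deriv_linear[OF x(1,2)]])
  moreover have "linear (frechet_derivative (\<lambda>u. f (x u)) (at u))"
    using mdiffD[OF x(1,2), of f] assms(3) x(3) by (simp add: linear_frechet_derivative)
  ultimately show ?thesis
    using mderiv_chart[OF x(1,2), of f] assms(3) x(3) v' w' by (simp add: linear_add)
qed

lemma mderiv_scaleR_vector:
  assumes "v \<in> tangent_space M p" "mdiff f p"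
  shows "mderiv M f p (c *\<^sub>R v) = c *\<^sub>R mderiv M f p v"
proof -
  obtain V x u where x: "(V, x) \<in> atlas M" "u \<in> V" "p = x u"
    using mdiffE[OF assms(2)] by metis
  obtain v' where v': "v = frechet_derivative (\<lambda>u. imm M (x u)) (at u) v'"
    using assms(1) tangent_space_chart[OF x(1,2)] x(3) by auto
  have "c *\<^sub>R v = frechet_derivative (\<lambda>u. imm M (x u)) (at u) (c *\<^sub>R v')"
    by (simp add: v' linear_scale[OF imm_deriv_linear[OF x(1,2)]])
  moreover have "linear (frechet_derivative (\<lambda>u. f (x u)) (at u))"
    using mdiffD[OF x(1,2), of f] assms(2) x(3) by (simp add: linear_frechet_derivative)
  ultimately show ?thesis
    using mderiv_chart[OF x(1,2), of f] assms(2) x(3) v' by (simp add: linear_scale)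
qed

lemma mderiv_minus_vector:
  "v \<in> tangent_space M p \<Longrightarrow> mdiff f p \<Longrightarrow> mderiv M f p (- v) = - mderiv M f p v"
  using mderiv_scaleR_vector[of v p f "-1"] by simp

lemma mderiv_diff_vector:
  assumes "v \<in> tangent_space M p" "w \<in> tangent_space M p" "mdiff f p"
  shows "mderiv M f p (v - w) = mderiv M f p v - mderiv M f p w"
proof -
  have "- w \<in> tangent_space M p"
    using assms subspace_tangent_space[OF mdiff_topspace[OF assms(3)]] by (simp add: subspace_neg)
  then show ?thesis
    using mderiv_add_vector[OF assms(1) _ assms(3), of "- w"] assms by (simp add: mderiv_minus_vector)
qed

lemma mderiv_sum_vector:
  assumes "\<And>i. i \<in> I \<Longrightarrow> v i \<in> tangent_space M p" "mdiff f p"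
  shows "mderiv M f p (\<Sum>i\<in>I. c i *\<^sub>R v i) = (\<Sum>i\<in>I. c i *\<^sub>R mderiv M f p (v i))"
proof -
  note sub = subspace_tangent_space[OF mdiff_topspace[OF assms(2)]]
  have "mderiv M f p 0 = 0"
    using mderiv_scaleR_vector[OF subspace_0[OF sub] assms(2), of 0] by simp
  then show ?thesis
    using assms(1)
    by (induction I rule: infinite_finite_induct)
      (simp_all add: mderiv_add_vector mderiv_scaleR_vector subspace_sum subspace_scale sub assms(2))
qed

text \<open>Many fields are introduced by descriptions, choices or projections and get an explicit
  formula only on an open set. This lemma differentiates them through such a formula.\<close>

lemma mdiff_cong:
  assumes "mdiff f p" "openin (mtop M) U" "p \<in> U" "\<And>q. q \<in> U \<Longrightarrow> f q = g q"
  shows "mdiff g p"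
    and "v \<in> tangent_space M p \<Longrightarrow> mderiv M g p v = mderiv M f p v"
proof -
  obtain V x u where x: "(V, x) \<in> atlas M" "u \<in> V" "p = x u"
    and f: "((\<lambda>u. f (x u)) has_derivative frechet_derivative (\<lambda>u. f (x u)) (at u)) (at u)"
    using assms(1) by (rule mdiffE)
  have g: "((\<lambda>u. g (x u)) has_derivative frechet_derivative (\<lambda>u. f (x u)) (at u)) (at u)"
    by (rule has_derivative_transform_within_open[OF f chart_preimage_open[OF x(1) assms(2)]])
      (use x assms in auto)
  then show "mdiff g p"
    using x by (auto simp: differentiable_def intro!: mdiffI)
  assume "v \<in> tangent_space M p"
  then obtain w where "v = frechet_derivative (\<lambda>u. imm M (x u)) (at u) w"
    using tangent_space_chart[OF x(1,2)] x(3) by auto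
  then show "mderiv M g p v = mderiv M f p v"
    using mderiv_chart_eqI[OF x(1,2) g] mderiv_chart_eqI[OF x(1,2) f] x(3) by simp
qed

lemma mdiff_add:
  assumes "mdiff f p" "mdiff g p"
  shows "mdiff (\<lambda>q. f q + g q) p"
    and "v \<in> tangent_space M p \<Longrightarrow> mderiv M (\<lambda>q. f q + g q) p v = mderiv M f p v + mderiv M g p v"
proof -
  obtain V x u where x: "(V, x) \<in> atlas M" "u \<in> V" "p = x u"
    and f: "((\<lambda>u. f (x u)) has_derivative frechet_derivative (\<lambda>u. f (x u)) (at u)) (at u)"
    using assms(1) by (rule mdiffE)
  have g: "((\<lambda>u. g (x u)) has_derivative frechet_derivative (\<lambda>u. g (x u)) (at u)) (at u)"
    using mdiffD[OF x(1,2)] assms(2) x(3) by (simp add: frechet_derivative_works)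
  note fg = has_derivative_add[OF f g]
  then show "mdiff (\<lambda>q. f q + g q) p"
    using x by (auto simp: differentiable_def intro!: mdiffI)
  assume "v \<in> tangent_space M p"
  then obtain w where "v = frechet_derivative (\<lambda>u. imm M (x u)) (at u) w"
    using tangent_space_chart[OF x(1,2)] x(3) by auto
  then show "mderiv M (\<lambda>q. f q + g q) p v = mderiv M f p v + mderiv M g p v"
    using mderiv_chart_eqI[OF x(1,2) f] mderiv_chart_eqI[OF x(1,2) g]
      mderiv_chart_eqI[OF x(1,2), of "\<lambda>q. f q + g q", OF fg] x(3) by simp
qed

lemma mdiff_bilinear:
  assumes "bounded_bilinear B" "mdiff f p" "mdiff g p"
  shows "mdiff (\<lambda>q. B (f q) (g q)) p"
    and "v \<in> tangent_space M p \<Longrightarrow>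
      mderiv M (\<lambda>q. B (f q) (g q)) p v = B (f p) (mderiv M g p v) + B (mderiv M f p v) (g p)"
proof -
  obtain V x u where x: "(V, x) \<in> atlas M" "u \<in> V" "p = x u"
    and f: "((\<lambda>u. f (x u)) has_derivative frechet_derivative (\<lambda>u. f (x u)) (at u)) (at u)"
    using assms(2) by (rule mdiffE)
  have g: "((\<lambda>u. g (x u)) has_derivative frechet_derivative (\<lambda>u. g (x u)) (at u)) (at u)"
    using mdiffD[OF x(1,2)] assms(3) x(3) by (simp add: frechet_derivative_works)
  note fg = bounded_bilinear.FDERIV[OF assms(1) f g]
  then show "mdiff (\<lambda>q. B (f q) (g q)) p"
    using x by (auto simp: differentiable_def intro!: mdiffI)
  assume "v \<in> tangent_space M p"
  then obtain w where "v = frechet_derivative (\<lambda>u. imm M (x u)) (at u) w"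
    using tangent_space_chart[OF x(1,2)] x(3) by auto
  then show "mderiv M (\<lambda>q. B (f q) (g q)) p v = B (f p) (mderiv M g p v) + B (mderiv M f p v) (g p)"
    using mderiv_chart_eqI[OF x(1,2) f] mderiv_chart_eqI[OF x(1,2) g]
      mderiv_chart_eqI[OF x(1,2), of "\<lambda>q. B (f q) (g q)", OF fg] x(3) by simp
qed

lemmas mdiff_inner = mdiff_bilinear[OF bounded_bilinear_inner]
lemmas mdiff_scaleR = mdiff_bilinear[OF bounded_bilinear_scaleR]

lemma mdiff_scaleR_const:
  assumes "mdiff f p"
  shows "mdiff (\<lambda>q. c *\<^sub>R f q) p"
    and "v \<in> tangent_space M p \<Longrightarrow> mderiv M (\<lambda>q. c *\<^sub>R f q) p v = c *\<^sub>R mderiv M f p v"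
  using mdiff_scaleR[OF mdiff_const[where c = c] assms] mdiff_topspace[OF assms]
  by (simp_all add: mderiv_const)

lemma mdiff_minus:
  assumes "mdiff f p"
  shows "mdiff (\<lambda>q. - f q) p"
    and "v \<in> tangent_space M p \<Longrightarrow> mderiv M (\<lambda>q. - f q) p v = - mderiv M f p v"
  using mdiff_scaleR_const[OF assms, where c = "-1"] by simp_all

lemma mdiff_sum:
  assumes "p \<in> topspace (mtop M)" "\<And>i. i \<in> I \<Longrightarrow> mdiff (f i) p"
  shows "mdiff (\<lambda>q. \<Sum>i\<in>I. f i q) p"
    and "v \<in> tangent_space M p \<Longrightarrow> mderiv M (\<lambda>q. \<Sum>i\<in>I. f i q) p v = (\<Sum>i\<in>I. mderiv M (f i) p v)"
proof -
  have "mdiff (\<lambda>q. \<Sum>i\<in>I. f i q) p \<and>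
    (v \<in> tangent_space M p \<longrightarrow> mderiv M (\<lambda>q. \<Sum>i\<in>I. f i q) p v = (\<Sum>i\<in>I. mderiv M (f i) p v))"
    using assms(2)
    by (induction I rule: infinite_finite_induct)
      (simp_all add: mdiff_add mdiff_const mderiv_const assms(1))
  then show "mdiff (\<lambda>q. \<Sum>i\<in>I. f i q) p"
    and "v \<in> tangent_space M p \<Longrightarrow> mderiv M (\<lambda>q. \<Sum>i\<in>I. f i q) p v = (\<Sum>i\<in>I. mderiv M (f i) p v)"
    by blast+
qed

section \<open>Smooth functions and tangent fields\<close>

lemma smooth_fun_onD:
  "smooth_fun_on M U f \<Longrightarrow> (V, x) \<in> atlas M \<Longrightarrow> smooth_on {u \<in> V. x u \<in> U} (\<lambda>u. f (x u))"
  by (auto simp: smooth_fun_on_def)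

lemma smooth_fun_onI:
  "(\<And>V x. (V, x) \<in> atlas M \<Longrightarrow> smooth_on {u \<in> V. x u \<in> U} (\<lambda>u. f (x u))) \<Longrightarrow> smooth_fun_on M U f"
  by (auto simp: smooth_fun_on_def)

lemma smooth_fun_on_mdiff:
  assumes "openin (mtop M) U" "smooth_fun_on M U f" "p \<in> U"
  shows "mdiff f p"
proof -
  obtain V x u where x: "(V, x) \<in> atlas M" "u \<in> V" "p = x u"
    using chart_around openin_subset assms by blast
  then show ?thesis
    using smooth_on_differentiable[OF smooth_fun_onD[OF assms(2) x(1)], of u] assms(3)
    by (auto intro: mdiffI)
qed

lemma smooth_fun_on_subset: "smooth_fun_on M U f \<Longrightarrow> U' \<subseteq> U \<Longrightarrow> smooth_fun_on M U' f"
  by (rule smooth_fun_onI, rule smooth_on_subset[OF smooth_fun_onD]) auto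

lemma smooth_fun_on_cong:
  assumes "openin (mtop M) U" "smooth_fun_on M U f" "\<And>q. q \<in> U \<Longrightarrow> f q = g q"
  shows "smooth_fun_on M U g"
proof (rule smooth_fun_onI)
  fix V x assume x: "(V, x) \<in> atlas M"
  show "smooth_on {u \<in> V. x u \<in> U} (\<lambda>u. g (x u))"
    by (rule smooth_on_cong[OF smooth_fun_onD[OF assms(2) x] chart_preimage_open[OF x assms(1)]])
      (simp add: assms(3))
qed

lemma smooth_fun_on_const: "smooth_fun_on M U (\<lambda>q. c)"
  by (intro smooth_fun_onI smooth_on_const)

lemma smooth_fun_on_diff:
  "openin (mtop M) U \<Longrightarrow> smooth_fun_on M U f \<Longrightarrow> smooth_fun_on M U g \<Longrightarrow> smooth_fun_on M U (\<lambda>q. f q - g q)"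
  by (rule smooth_fun_onI) (simp add: smooth_on_diff chart_preimage_open smooth_fun_onD)

lemma smooth_fun_on_minus:
  "openin (mtop M) U \<Longrightarrow> smooth_fun_on M U f \<Longrightarrow> smooth_fun_on M U (\<lambda>q. - f q)"
  by (rule smooth_fun_onI) (simp add: smooth_on_minus chart_preimage_open smooth_fun_onD)

lemma smooth_fun_on_scaleR:
  "openin (mtop M) U \<Longrightarrow> smooth_fun_on M U f \<Longrightarrow> smooth_fun_on M U g \<Longrightarrow> smooth_fun_on M U (\<lambda>q. f q *\<^sub>R g q)"
  by (rule smooth_fun_onI) (simp add: smooth_on_scaleR chart_preimage_open smooth_fun_onD)

lemma smooth_fun_on_inner:
  "openin (mtop M) U \<Longrightarrow> smooth_fun_on M U f \<Longrightarrow> smooth_fun_on M U g \<Longrightarrow> smooth_fun_on M U (\<lambda>q. f q \<bullet> g q)"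
  by (rule smooth_fun_onI) (simp add: smooth_on_inner chart_preimage_open smooth_fun_onD)

lemma smooth_fun_on_sum:
  "openin (mtop M) U \<Longrightarrow> (\<And>i. i \<in> I \<Longrightarrow> smooth_fun_on M U (f i)) \<Longrightarrow> smooth_fun_on M U (\<lambda>q. \<Sum>i\<in>I. f i q)"
  by (rule smooth_fun_onI) (simp add: smooth_on_sum chart_preimage_open smooth_fun_onD)

lemma tangent_field_onD:
  assumes "tangent_field_on M U X"
  shows "openin (mtop M) U" "smooth_fun_on M U X" "p \<in> U \<Longrightarrow> X p \<in> tangent_space M p"
    "p \<in> U \<Longrightarrow> p \<in> topspace (mtop M)"
  using assms openin_subset by (auto simp: tangent_field_on_def)

text \<open>Smoothness of the coordinates is the issue, since they come from inverting a linear map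
  that varies with u. Near each point, expand X in an orthonormal frame of images of coordinate
  fields \<zeta> i: the coefficients are inner products, hence smooth, and injectivity identifies
  \<xi> with the same combination of the \<zeta> i.\<close>

lemma tangent_field_coordinates:
  assumes X: "tangent_field_on M U X" and x: "(V, x) \<in> atlas M"
  obtains \<xi> where "smooth_on {u \<in> V. x u \<in> U} \<xi>"
    "\<And>u. u \<in> V \<Longrightarrow> x u \<in> U \<Longrightarrow> X (x u) = frechet_derivative (\<lambda>u. imm M (x u)) (at u) (\<xi> u)"
proof -
  let ?D = "\<lambda>u. frechet_derivative (\<lambda>u. imm M (x u)) (at u)"
  let ?S = "{u \<in> V. x u \<in> U}"
  \<comment> \<open>\<open>?D u\<close> is injective but in general not surjective;
    \<open>inv\<close> is a true inverse only on its range, which is the tangent space containing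
    X.\<close>
  define \<xi> where "\<xi> u = inv (?D u) (X (x u))" for u
  have S: "open ?S" by (rule chart_preimage_open[OF x tangent_field_onD(1)[OF X]])
  have lift: "X (x u) = ?D u (\<xi> u)" if "u \<in> V" "x u \<in> U" for u
    using tangent_field_onD(3)[OF X that(2)] tangent_space_chart[OF x that(1)]
    by (simp add: \<xi>_def f_inv_into_f)
  have "smooth_on ?S \<xi>"
  proof (rule smooth_on_local)
    fix u0 assume u0: "u0 \<in> ?S"
    have F: "smooth_on ?S (\<lambda>u. imm M (x u))"
      by (rule smooth_on_subset[OF imm_chart_smooth[OF x]]) auto
    obtain W \<zeta> where W: "open W" "u0 \<in> W" "W \<subseteq> ?S"
      and \<zeta>: "\<And>i. i < DIM('m) \<Longrightarrow> smooth_on W (\<zeta> i)"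
      and on: "\<And>u i j. u \<in> W \<Longrightarrow> i < DIM('m) \<Longrightarrow> j < DIM('m) \<Longrightarrow>
        ?D u (\<zeta> i u) \<bullet> ?D u (\<zeta> j u) = (if i = j then 1 else 0)"
      by (rule immersion_orthonormal_frame[OF S u0 F]) (use imm_deriv_inj[OF x] in auto)
    have FW: "smooth_on W (\<lambda>u. imm M (x u))" by (rule smooth_on_subset[OF F W(3)])
    have XW: "smooth_on W (\<lambda>u. X (x u))"
      by (rule smooth_on_subset[OF smooth_fun_onD[OF tangent_field_onD(2)[OF X] x] W(3)])
    have "smooth_on W \<xi>"
    proof (rule smooth_on_cong)
      show "smooth_on W (\<lambda>u. \<Sum>i<DIM('m). (X (x u) \<bullet> ?D u (\<zeta> i u)) *\<^sub>R \<zeta> i u)"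
        by (intro smooth_on_sum smooth_on_scaleR smooth_on_inner W(1) XW \<zeta>
            smooth_on_frechet_derivative_field[OF W(1) FW]) auto
      fix u assume u: "u \<in> W"
      then have uV: "u \<in> V" "x u \<in> U" using W by auto
      note T = subspace_tangent_space[OF chart_in_topspace[OF x uV(1)]]
        dim_tangent_space[OF chart_in_topspace[OF x uV(1)]]
      have "X (x u) = (\<Sum>i<DIM('m). (X (x u) \<bullet> ?D u (\<zeta> i u)) *\<^sub>R ?D u (\<zeta> i u))"
        by (rule orthonormal_expansion[OF T _ on[OF u]])
          (auto simp: tangent_space_chart[OF x uV(1)] lift[OF uV])
      then have "?D u (\<Sum>i<DIM('m). (X (x u) \<bullet> ?D u (\<zeta> i u)) *\<^sub>R \<zeta> i u) = ?D u (\<xi> u)"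
        using imm_deriv_linear[OF x uV(1)] by (simp add: linear_sum linear_scale lift[OF uV])
      then show "(\<Sum>i<DIM('m). (X (x u) \<bullet> ?D u (\<zeta> i u)) *\<^sub>R \<zeta> i u) = \<xi> u"
        by (rule injD[OF imm_deriv_inj[OF x uV(1)]])
    qed (rule W(1))
    then show "\<exists>T. open T \<and> u0 \<in> T \<and> smooth_on T \<xi>" using W by blast
  qed
  with lift show thesis using that by blast
qed

lemma smooth_fun_on_mderiv:
  fixes f :: "'a \<Rightarrow> 'b::real_normed_vector"
  assumes X: "tangent_field_on M U X" and f: "smooth_fun_on M U f"
  shows "smooth_fun_on M U (\<lambda>q. mderiv M f q (X q))"
proof (rule smooth_fun_onI)
  fix V x assume x: "(V, x) \<in> atlas M"
  note U = tangent_field_onD(1)[OF X]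
  let ?S = "{u \<in> V. x u \<in> U}"
  obtain \<xi> where \<xi>: "smooth_on ?S \<xi>"
    "\<And>u. u \<in> V \<Longrightarrow> x u \<in> U \<Longrightarrow> X (x u) = frechet_derivative (\<lambda>u. imm M (x u)) (at u) (\<xi> u)"
    using tangent_field_coordinates[OF X x] by blast
  have S: "open ?S" by (rule chart_preimage_open[OF x U])
  show "smooth_on ?S (\<lambda>u. mderiv M f (x u) (X (x u)))"
  proof (rule smooth_on_cong)
    show "smooth_on ?S (\<lambda>u. frechet_derivative (\<lambda>u. f (x u)) (at u) (\<xi> u))"
      by (rule smooth_on_frechet_derivative_field[OF S smooth_fun_onD[OF f x] \<xi>(1)])
    fix u assume "u \<in> ?S"
    then show "frechet_derivative (\<lambda>u. f (x u)) (at u) (\<xi> u) = mderiv M f (x u) (X (x u))"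
      using mderiv_chart[OF x, of u f "\<xi> u"] smooth_fun_on_mdiff[OF U f] \<xi>(2) by simp
  qed (rule S)
qed

text \<open>In a chart both sides reduce to the derivative along the coordinate bracket
  \<open>?b\<close>, as the Hessian terms cancel. Applied to the immersion itself, this shows that
  the flat bracket D_X Y - D_Y X is the image of \<open>?b\<close> and hence tangent; applied to f,
  it gives the commutator formula.\<close>

lemma mderiv_commutator:
  fixes f :: "'a \<Rightarrow> 'b::euclidean_space"
  assumes X: "tangent_field_on M U X" and Y: "tangent_field_on M U Y" and f: "smooth_fun_on M U f"
    and p: "p \<in> U"
  shows "mderiv M Y p (X p) - mderiv M X p (Y p) \<in> tangent_space M p"
    and "mderiv M (\<lambda>q. mderiv M f q (Y q)) p (X p) - mderiv M (\<lambda>q. mderiv M f q (X q)) p (Y p) =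
      mderiv M f p (mderiv M Y p (X p) - mderiv M X p (Y p))"
proof -
  note U = tangent_field_onD(1)[OF X]
  obtain V x u0 where x: "(V, x) \<in> atlas M" and u0: "u0 \<in> V" "p = x u0"
    using chart_around[OF tangent_field_onD(4)[OF X p]] .
  let ?S = "{u \<in> V. x u \<in> U}" and ?F = "\<lambda>u. imm M (x u)"
  have S: "open ?S" by (rule chart_preimage_open[OF x U])
  have u0S: "u0 \<in> ?S" using u0 p by simp
  obtain \<xi> where \<xi>: "smooth_on ?S \<xi>"
    "\<And>u. u \<in> V \<Longrightarrow> x u \<in> U \<Longrightarrow> X (x u) = frechet_derivative ?F (at u) (\<xi> u)"
    using tangent_field_coordinates[OF X x] by blast
  obtain \<eta> where \<eta>: "smooth_on ?S \<eta>"
    "\<And>u. u \<in> V \<Longrightarrow> x u \<in> U \<Longrightarrow> Y (x u) = frechet_derivative ?F (at u) (\<eta> u)"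
    using tangent_field_coordinates[OF Y x] by blast
  have F: "smooth_on ?S ?F" by (rule smooth_on_subset[OF imm_chart_smooth[OF x]]) auto
  let ?b = "frechet_derivative \<eta> (at u0) (\<xi> u0) - frechet_derivative \<xi> (at u0) (\<eta> u0)"
  \<comment> \<open>The target type is left general because the identity serves both for the
    immersion and for f in this chart.\<close>
  have comm: "frechet_derivative (\<lambda>u. frechet_derivative g (at u) (\<eta> u)) (at u0) (\<xi> u0) -
      frechet_derivative (\<lambda>u. frechet_derivative g (at u) (\<xi> u)) (at u0) (\<eta> u0) =
      frechet_derivative g (at u0) ?b"
    if g: "smooth_on ?S g" for g :: "'m \<Rightarrow> 'c::euclidean_space"
    using second_derivative_symmetric[OF S u0S g, of "\<eta> u0" "\<xi> u0"]
      frechet_derivative_frechet_derivative_field[OF S g \<eta>(1) u0S, of "\<xi> u0"]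
      frechet_derivative_frechet_derivative_field[OF S g \<xi>(1) u0S, of "\<eta> u0"]
      linear_diff[OF linear_frechet_derivative[OF smooth_on_differentiable[OF g u0S]]]
    by simp
  have field: "mderiv M Z p (frechet_derivative ?F (at u0) w) = frechet_derivative G (at u0) w"
    if "smooth_fun_on M U Z" "\<And>u. u \<in> ?S \<Longrightarrow> Z (x u) = G u"
    for Z :: "'a \<Rightarrow> 'c::real_normed_vector" and G w
  proof -
    have "((\<lambda>u. Z (x u)) has_derivative frechet_derivative (\<lambda>u. Z (x u)) (at u0)) (at u0)"
      by (rule smooth_on_has_derivative[OF smooth_fun_onD[OF that(1) x] u0S])
    then have "(G has_derivative frechet_derivative (\<lambda>u. Z (x u)) (at u0)) (at u0)"
      by (rule has_derivative_transform_within_open[OF _ S u0S]) (rule that(2))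
    then have "frechet_derivative G (at u0) = frechet_derivative (\<lambda>u. Z (x u)) (at u0)"
      by (rule frechet_derivative_eqI)
    then show ?thesis
      using mderiv_chart[OF x u0(1), of Z w] smooth_fun_on_mdiff[OF U that(1) p] u0(2) by simp
  qed
  have Xp: "X p = frechet_derivative ?F (at u0) (\<xi> u0)" and Yp: "Y p = frechet_derivative ?F (at u0) (\<eta> u0)"
    using \<xi>(2) \<eta>(2) u0 p by auto
  have 1: "mderiv M Y p (X p) - mderiv M X p (Y p) = frechet_derivative ?F (at u0) ?b"
    unfolding Xp Yp
    by (subst (1 2) field) (use X Y \<xi>(2) \<eta>(2) comm[OF F] in \<open>auto simp: tangent_field_on_def\<close>)
  then show "mderiv M Y p (X p) - mderiv M X p (Y p) \<in> tangent_space M p"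
    using tangent_space_chart[OF x u0(1)] u0(2) by simp
  have df: "mderiv M f (x u) (frechet_derivative ?F (at u) w) = frechet_derivative (\<lambda>u. f (x u)) (at u) w"
    if "u \<in> ?S" for u w
    using that mderiv_chart[OF x, of u f w] smooth_fun_on_mdiff[OF U f] by simp
  have 2: "mderiv M (\<lambda>q. mderiv M f q (Y q)) p (X p) =
      frechet_derivative (\<lambda>u. frechet_derivative (\<lambda>u. f (x u)) (at u) (\<eta> u)) (at u0) (\<xi> u0)"
    unfolding Xp by (rule field[OF smooth_fun_on_mderiv[OF Y f]]) (use \<eta>(2) df in auto)
  have 3: "mderiv M (\<lambda>q. mderiv M f q (X q)) p (Y p) =
      frechet_derivative (\<lambda>u. frechet_derivative (\<lambda>u. f (x u)) (at u) (\<xi> u)) (at u0) (\<eta> u0)"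
    unfolding Yp by (rule field[OF smooth_fun_on_mderiv[OF X f]]) (use \<xi>(2) df in auto)
  show "mderiv M (\<lambda>q. mderiv M f q (Y q)) p (X p) - mderiv M (\<lambda>q. mderiv M f q (X q)) p (Y p) =
      mderiv M f p (mderiv M Y p (X p) - mderiv M X p (Y p))"
    by (simp only: 1 2 3 comm[OF smooth_fun_onD[OF f x]]) (simp only: u0(2) df[OF u0S])
qed

section \<open>Orthonormal frames and traces\<close>

text \<open>Gives meaning to the \<open>SOME\<close> in \<open>trace_at\<close>. The frame is built
  in one chart; seen from another chart it is composed with the transition map and so stays
  smooth.\<close>

lemma orthonormal_frame_exists:
  assumes p: "p \<in> topspace (mtop M)"
  shows "\<exists>E U. p \<in> U \<and> orthonormal_frame_on M U E"
proof -
  obtain V x u0 where x: "(V, x) \<in> atlas M" and u0: "u0 \<in> V" "p = x u0"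
    using chart_around[OF p] .
  let ?D = "\<lambda>u. frechet_derivative (\<lambda>u. imm M (x u)) (at u)"
  obtain W \<zeta> where W: "open W" "u0 \<in> W" "W \<subseteq> V"
    and \<zeta>: "\<And>i. i < DIM('m) \<Longrightarrow> smooth_on W (\<zeta> i)"
    and on: "\<And>u i j. u \<in> W \<Longrightarrow> i < DIM('m) \<Longrightarrow> j < DIM('m) \<Longrightarrow>
      ?D u (\<zeta> i u) \<bullet> ?D u (\<zeta> j u) = (if i = j then 1 else 0)"
    by (rule immersion_orthonormal_frame[OF chart_open[OF x] u0(1) imm_chart_smooth[OF x] imm_deriv_inj[OF x]]) blast+
  define E where "E i q = ?D (inv_into V x q) (\<zeta> i (inv_into V x q))" for i q
  have inv: "inv_into V x (x u) = u" if "u \<in> V" for u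
    using chart_inj_on[OF x] that by simp
  have "tangent_field_on M (x ` W) (E i)" if i: "i < DIM('m)" for i
    unfolding tangent_field_on_def
  proof (intro conjI ballI)
    show "openin (mtop M) (x ` W)" by (rule chart_image_open[OF x W(1,3)])
    then have open_y: "open {v \<in> V'. y v \<in> x ` W}" if "(V', y) \<in> atlas M" for V' y
      using chart_preimage_open that by blast
    show "smooth_fun_on M (x ` W) (E i)"
    proof (rule smooth_fun_onI)
      fix V' y assume y: "(V', y) \<in> atlas M"
      show "smooth_on {v \<in> V'. y v \<in> x ` W} (\<lambda>v. E i (y v))"
        unfolding E_def
      proof (rule smooth_on_compose[OF open_y[OF y] W(1)])
        show "(\<lambda>v. inv_into V x (y v)) ` {v \<in> V'. y v \<in> x ` W} \<subseteq> W"
          using inv W(3) by auto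
        show "smooth_on {v \<in> V'. y v \<in> x ` W} (\<lambda>v. inv_into V x (y v))"
          by (rule smooth_on_subset[OF transition(2)[OF y x]]) (use W(3) in auto)
        show "smooth_on W (\<lambda>u. ?D u (\<zeta> i u))"
          by (rule smooth_on_frechet_derivative_field[OF W(1) smooth_on_subset[OF imm_chart_smooth[OF x] W(3)] \<zeta>[OF i]])
      qed
    qed
    fix q assume "q \<in> x ` W"
    then show "E i q \<in> tangent_space M q"
      using inv W(3) tangent_space_chart[OF x] by (auto simp: E_def)
  qed
  moreover have "E i q \<bullet> E j q = (if i = j then 1 else 0)"
    if "q \<in> x ` W" "i < DIM('m)" "j < DIM('m)" for i j q
    using that on W(3) inv by (auto simp: E_def)
  ultimately have "orthonormal_frame_on M (x ` W) E"
    by (auto simp: orthonormal_frame_on_def)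
  then show ?thesis using W(2) u0(2) by blast
qed

lemma orthonormal_frame_onD:
  assumes "orthonormal_frame_on M U E"
  shows "openin (mtop M) U" "i < DIM('m) \<Longrightarrow> tangent_field_on M U (E i)"
    "p \<in> U \<Longrightarrow> i < DIM('m) \<Longrightarrow> E i p \<in> tangent_space M p"
    "p \<in> U \<Longrightarrow> i < DIM('m) \<Longrightarrow> j < DIM('m) \<Longrightarrow> E i p \<bullet> E j p = (if i = j then 1 else 0)"
    "p \<in> U \<Longrightarrow> p \<in> topspace (mtop M)"
proof -
  \<comment> \<open>Openness of \<open>U\<close> is recorded only through the fields of the frame.
    Index 0 is in range because the dimension is positive.\<close>
  have 0: "tangent_field_on M U (E 0)"
    using assms DIM_positive[where 'a = 'm] by (simp add: orthonormal_frame_on_def)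
  show "openin (mtop M) U" "p \<in> U \<Longrightarrow> p \<in> topspace (mtop M)"
    using tangent_field_onD[OF 0] by auto
qed (use assms in \<open>auto simp: orthonormal_frame_on_def tangent_field_on_def\<close>)

lemma frame_expansion:
  assumes "orthonormal_frame_on M U E" "p \<in> U" "v \<in> tangent_space M p"
  shows "v = (\<Sum>i<DIM('m). (v \<bullet> E i p) *\<^sub>R E i p)"
  using assms orthonormal_frame_onD[OF assms(1)]
  by (intro orthonormal_expansion[of "tangent_space M p"] subspace_tangent_space dim_tangent_space) auto

text \<open>The change of frame is an orthogonal matrix, so \<Sum>_i a_ij a_ik = \<delta>_jk.
  Linearity is asked only on tangent vectors, because the forms b used later are built from
  \<open>mderiv\<close>, which is linear only there.\<close>

lemma trace_independent_of_frame:
  fixes b :: "'e \<Rightarrow> 'e \<Rightarrow> 'b::real_vector"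
  assumes E: "orthonormal_frame_on M U E" "p \<in> U" and E': "orthonormal_frame_on M U' E'" "p \<in> U'"
    and left: "\<And>c w. w \<in> tangent_space M p \<Longrightarrow>
      b (\<Sum>i<DIM('m). c i *\<^sub>R E i p) w = (\<Sum>i<DIM('m). c i *\<^sub>R b (E i p) w)"
    and right: "\<And>c v. v \<in> tangent_space M p \<Longrightarrow>
      b v (\<Sum>i<DIM('m). c i *\<^sub>R E i p) = (\<Sum>i<DIM('m). c i *\<^sub>R b v (E i p))"
  shows "(\<Sum>i<DIM('m). b (E' i p) (E' i p)) = (\<Sum>i<DIM('m). b (E i p) (E i p))"
proof -
  let ?n = "DIM('m)"
  note D = orthonormal_frame_onD[OF E(1)] and D' = orthonormal_frame_onD[OF E'(1)]
  define a where "a i j = E' i p \<bullet> E j p" for i j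
  have E'_eq: "E' i p = (\<Sum>j<?n. a i j *\<^sub>R E j p)" if "i < ?n" for i
    unfolding a_def by (rule frame_expansion[OF E D'(3)[OF E'(2) that]])
  have "b (E' i p) (E' i p) = (\<Sum>j<?n. \<Sum>k<?n. (a i j * a i k) *\<^sub>R b (E j p) (E k p))" if i: "i < ?n" for i
  proof -
    have "b (E' i p) (E' i p) = (\<Sum>j<?n. a i j *\<^sub>R b (E j p) (E' i p))"
      using left[of "E' i p" "a i"] D'(3)[OF E'(2) i] E'_eq[OF i] by simp
    also have "\<dots> = (\<Sum>j<?n. a i j *\<^sub>R (\<Sum>k<?n. a i k *\<^sub>R b (E j p) (E k p)))"
    proof (intro sum.cong refl)
      fix j assume "j \<in> {..<?n}"
      then show "a i j *\<^sub>R b (E j p) (E' i p) = a i j *\<^sub>R (\<Sum>k<?n. a i k *\<^sub>R b (E j p) (E k p))"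
        using right[of "E j p" "a i"] D(3)[OF E(2)] E'_eq[OF i] by simp
    qed
    finally show ?thesis by (simp add: scaleR_sum_right)
  qed
  then have "(\<Sum>i<?n. b (E' i p) (E' i p)) =
      (\<Sum>i<?n. \<Sum>j<?n. \<Sum>k<?n. (a i j * a i k) *\<^sub>R b (E j p) (E k p))"
    by simp
  also have "\<dots> = (\<Sum>j<?n. \<Sum>i<?n. \<Sum>k<?n. (a i j * a i k) *\<^sub>R b (E j p) (E k p))"
    by (rule sum.swap)
  also have "\<dots> = (\<Sum>j<?n. \<Sum>k<?n. \<Sum>i<?n. (a i j * a i k) *\<^sub>R b (E j p) (E k p))"
    by (intro sum.cong refl sum.swap)
  also have "\<dots> = (\<Sum>j<?n. \<Sum>k<?n. (\<Sum>i<?n. a i j * a i k) *\<^sub>R b (E j p) (E k p))"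
    by (simp add: scaleR_sum_left)
  also have "\<dots> = (\<Sum>j<?n. \<Sum>k<?n. if k = j then b (E j p) (E j p) else 0)"
  proof (intro sum.cong refl)
    fix j k assume jk: "j \<in> {..<?n}" "k \<in> {..<?n}"
    have "E j p \<bullet> E k p = (\<Sum>i<?n. (E j p \<bullet> E' i p) *\<^sub>R E' i p) \<bullet> E k p"
      using frame_expansion[OF E' D(3)[OF E(2)], of j] jk by simp
    also have "\<dots> = (\<Sum>i<?n. a i j * a i k)"
      by (simp add: inner_sum_left a_def inner_commute[of "E' _ p"])
    finally show "(\<Sum>i<?n. a i j * a i k) *\<^sub>R b (E j p) (E k p) = (if k = j then b (E j p) (E j p) else 0)"
      using D(4)[OF E(2), of j k] jk by auto
  qed
  finally show ?thesis by simp
qed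

text \<open>The chosen frame depends on M and p but not on F, so different traces at p can be
  compared term by term.\<close>

lemma trace_at_frame:
  fixes F :: "('a \<Rightarrow> 'e) \<Rightarrow> ('a \<Rightarrow> 'e) \<Rightarrow> 'a \<Rightarrow> 'b::comm_monoid_add"
  assumes "p \<in> topspace (mtop M)"
  defines "E \<equiv> SOME E. \<exists>U. p \<in> U \<and> orthonormal_frame_on M U E"
  shows "trace_at M F p = (\<Sum>i<DIM('m). F (E i) (E i) p)"
    and "\<exists>U. p \<in> U \<and> orthonormal_frame_on M U E"
  using someI_ex[OF orthonormal_frame_exists[OF assms(1)]] by (simp_all add: trace_at_def E_def Let_def)

section \<open>Second fundamental form and mean curvature\<close>

text \<open>In a smooth frame the projection has smooth coefficients; the Levi-Civita connection and
  the second fundamental form inherit smoothness from this formula.\<close>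

lemma orth_proj_tangent_frame:
  assumes E: "orthonormal_frame_on M U E" "p \<in> U"
  shows "orth_proj (tangent_space M p) v = (\<Sum>i<DIM('m). (v \<bullet> E i p) *\<^sub>R E i p)"
proof (rule orth_proj_eqI)
  note D = orthonormal_frame_onD[OF E(1)]
  show sub: "subspace (tangent_space M p)" by (rule subspace_tangent_space[OF D(5)[OF E(2)]])
  show "(\<Sum>i<DIM('m). (v \<bullet> E i p) *\<^sub>R E i p) \<in> tangent_space M p"
    using D(3)[OF E(2)] by (intro subspace_sum subspace_scale sub) auto
  fix w assume w: "w \<in> tangent_space M p"
  have "v \<bullet> w = v \<bullet> (\<Sum>i<DIM('m). (w \<bullet> E i p) *\<^sub>R E i p)"
    using frame_expansion[OF E w] by simp
  also have "\<dots> = (\<Sum>i<DIM('m). (v \<bullet> E i p) *\<^sub>R E i p) \<bullet> w"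
    by (simp add: inner_sum_right inner_sum_left inner_commute[of _ w] mult.commute)
  finally show "(v - (\<Sum>i<DIM('m). (v \<bullet> E i p) *\<^sub>R E i p)) \<bullet> w = 0"
    by (simp add: inner_diff_left)
qed

lemma orth_proj_tangent:
  assumes p: "p \<in> topspace (mtop M)"
  shows "orth_proj (tangent_space M p) v \<in> tangent_space M p"
    and "w \<in> tangent_space M p \<Longrightarrow> orth_proj (tangent_space M p) v \<bullet> w = v \<bullet> w"
    and "linear (orth_proj (tangent_space M p))"
    and "w \<in> tangent_space M p \<Longrightarrow> orth_proj (tangent_space M p) w = w"
proof -
  obtain E U where E: "p \<in> U" "orthonormal_frame_on M U E"
    using orthonormal_frame_exists[OF p] by blast
  note sub = subspace_tangent_space[OF p]
  note P = orth_proj_tangent_frame[OF E(2,1)]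
  show "orth_proj (tangent_space M p) v \<in> tangent_space M p"
    unfolding P using orthonormal_frame_onD(3)[OF E(2,1)]
    by (intro subspace_sum subspace_scale sub) auto
  show "linear (orth_proj (tangent_space M p))"
    by (rule linearI) (simp_all add: P inner_add_left scaleR_add_left sum.distrib scaleR_sum_right)
  show "w \<in> tangent_space M p \<Longrightarrow> orth_proj (tangent_space M p) w = w"
    using frame_expansion[OF E(2,1), of w] by (simp add: P)
  assume w: "w \<in> tangent_space M p"
  have "v \<bullet> w = v \<bullet> (\<Sum>i<DIM('m). (w \<bullet> E i p) *\<^sub>R E i p)"
    using frame_expansion[OF E(2,1) w] by simp
  then show "orth_proj (tangent_space M p) v \<bullet> w = v \<bullet> w"
    by (simp add: P inner_sum_right inner_sum_left inner_commute[of _ w] mult.commute)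
qed

lemma orth_proj_sphere:
  "p \<in> topspace (mtop M) \<Longrightarrow> orth_proj (sphere_tangent (imm M p)) v = v - (v \<bullet> imm M p) *\<^sub>R imm M p"
  by (simp add: orth_proj_sphere_tangent norm_imm)

text \<open>The tangent space of M is orthogonal to the position vector, so the radial part removed
  by the first projection is invisible to the second.\<close>

lemma orth_proj_tangent_sphere:
  assumes p: "p \<in> topspace (mtop M)"
  shows "orth_proj (tangent_space M p) (orth_proj (sphere_tangent (imm M p)) v) =
    orth_proj (tangent_space M p) v"
proof (rule orth_proj_eqI)
  fix w assume "w \<in> tangent_space M p"
  then show "(orth_proj (sphere_tangent (imm M p)) v - orth_proj (tangent_space M p) v) \<bullet> w = 0"
    using orth_proj_tangent(2)[OF p, of w v] tangent_orthogonal_imm[OF p, of w]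
    by (simp add: orth_proj_sphere[OF p] inner_diff_left inner_commute[of "imm M p"])
qed (use p in \<open>auto intro: subspace_tangent_space orth_proj_tangent\<close>)

lemma orth_proj_sphere_of_tangent:
  "p \<in> topspace (mtop M) \<Longrightarrow> w \<in> tangent_space M p \<Longrightarrow> orth_proj (sphere_tangent (imm M p)) w = w"
  by (simp add: orth_proj_sphere tangent_orthogonal_imm)

lemma normal_spaceD:
  assumes "\<xi> \<in> normal_space M p"
  shows "\<xi> \<bullet> imm M p = 0" "imm M p \<bullet> \<xi> = 0" "w \<in> tangent_space M p \<Longrightarrow> \<xi> \<bullet> w = 0" "w \<in> tangent_space M p \<Longrightarrow> w \<bullet> \<xi> = 0"
  using assms by (auto simp: normal_space_def sphere_tangent_def inner_commute)

lemma subspace_normal_space: "subspace (normal_space M p)"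
  by (auto simp: subspace_def normal_space_def sphere_tangent_def inner_add_left)

lemma imm_orthogonal_tangent:
  "p \<in> topspace (mtop M) \<Longrightarrow> v \<in> tangent_space M p \<Longrightarrow> imm M p \<bullet> v = 0"
  by (simp add: tangent_orthogonal_imm inner_commute)

lemma normal_component:
  assumes p: "p \<in> topspace (mtop M)"
  shows "v - (v \<bullet> imm M p) *\<^sub>R imm M p - orth_proj (tangent_space M p) v \<in> normal_space M p"
proof -
  have 1: "imm M p \<bullet> imm M p = 1" using norm_imm[OF p] by (simp add: dot_square_norm)
  show ?thesis
    unfolding normal_space_def sphere_tangent_def
    using 1 tangent_orthogonal_imm[OF p orth_proj_tangent(1)[OF p, of v]] orth_proj_tangent(2)[OF p]
      imm_orthogonal_tangent[OF p]
    by (simp add: inner_diff_left)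
qed

text \<open>The ambient space is the orthogonal sum of the line through the position vector, the
  tangent space of M, and the normal space of M in the sphere.\<close>

lemma orth_proj_normal_eq:
  assumes p: "p \<in> topspace (mtop M)"
  shows "orth_proj (normal_space M p) v =
    v - (v \<bullet> imm M p) *\<^sub>R imm M p - orth_proj (tangent_space M p) v"
proof (rule orth_proj_eqI[OF subspace_normal_space normal_component[OF p]])
  fix w assume "w \<in> normal_space M p"
  then show "(v - (v - (v \<bullet> imm M p) *\<^sub>R imm M p - orth_proj (tangent_space M p) v)) \<bullet> w = 0"
    using normal_spaceD[of w p] orth_proj_tangent(1)[OF p, of v]
    by (simp add: inner_diff_left inner_add_left)
qed

lemma orth_proj_normal:
  assumes p: "p \<in> topspace (mtop M)"
  shows "orth_proj (normal_space M p) v \<in> normal_space M p"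
    and "\<xi> \<in> normal_space M p \<Longrightarrow> orth_proj (normal_space M p) v \<bullet> \<xi> = v \<bullet> \<xi>"
    and "linear (orth_proj (normal_space M p))"
    and "w \<in> tangent_space M p \<Longrightarrow> orth_proj (normal_space M p) w = 0"
    and "orth_proj (normal_space M p) (orth_proj (sphere_tangent (imm M p)) v) = orth_proj (normal_space M p) v"
proof -
  note lin = orth_proj_tangent(3)[OF p]
  have 1: "imm M p \<bullet> imm M p = 1" using norm_imm[OF p] by (simp add: dot_square_norm)
  show "orth_proj (normal_space M p) v \<in> normal_space M p"
    unfolding orth_proj_normal_eq[OF p] by (rule normal_component[OF p])
  show "\<xi> \<in> normal_space M p \<Longrightarrow> orth_proj (normal_space M p) v \<bullet> \<xi> = v \<bullet> \<xi>"
    using normal_spaceD[of \<xi> p] orth_proj_tangent(1)[OF p, of v]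
    by (simp add: orth_proj_normal_eq[OF p] inner_diff_left)
  show "linear (orth_proj (normal_space M p))"
    by (rule linearI) (simp_all add: orth_proj_normal_eq[OF p] linear_add[OF lin] linear_scale[OF lin]
        inner_add_left algebra_simps)
  show "w \<in> tangent_space M p \<Longrightarrow> orth_proj (normal_space M p) w = 0"
    by (simp add: orth_proj_normal_eq[OF p] tangent_orthogonal_imm[OF p] orth_proj_tangent(4)[OF p])
  show "orth_proj (normal_space M p) (orth_proj (sphere_tangent (imm M p)) v) = orth_proj (normal_space M p) v"
    using 1 by (simp add: orth_proj_normal_eq[OF p] orth_proj_tangent_sphere[OF p])
      (simp add: orth_proj_sphere[OF p] inner_diff_left)
qed

section \<open>Connections and second fundamental form as projections of flat derivatives\<close>

lemma levi_civita_eq: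
  "p \<in> topspace (mtop M) \<Longrightarrow> levi_civita M X Y p = orth_proj (tangent_space M p) (mderiv M Y p (X p))"
  by (simp add: levi_civita_def pullback_conn_def orth_proj_tangent_sphere)

lemma levi_civita_tangent: "p \<in> topspace (mtop M) \<Longrightarrow> levi_civita M X Y p \<in> tangent_space M p"
  by (simp add: levi_civita_eq orth_proj_tangent)

lemma second_fundamental_form_eq:
  "p \<in> topspace (mtop M) \<Longrightarrow>
    second_fundamental_form M X Y p = orth_proj (normal_space M p) (mderiv M Y p (X p))"
  by (simp add: second_fundamental_form_def pullback_conn_def orth_proj_normal)

lemma second_fundamental_form_normal:
  "p \<in> topspace (mtop M) \<Longrightarrow> second_fundamental_form M X Y p \<in> normal_space M p"
  by (simp add: second_fundamental_form_eq orth_proj_normal)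

lemma normal_conn_eq:
  "p \<in> topspace (mtop M) \<Longrightarrow>
    normal_conn M X \<xi> p = orth_proj (normal_space M p) (mderiv M \<xi> p (X p))"
  by (simp add: normal_conn_def pullback_conn_def orth_proj_normal)

lemma tangent_field_on_subset:
  assumes "tangent_field_on M U X" "openin (mtop M) W" "W \<subseteq> U"
  shows "tangent_field_on M W X"
  using assms smooth_fun_on_subset by (auto simp: tangent_field_on_def)

lemma tangent_field_on_mdiff: "tangent_field_on M U X \<Longrightarrow> p \<in> U \<Longrightarrow> mdiff X p"
  using smooth_fun_on_mdiff by (auto simp: tangent_field_on_def)

text \<open>Write Y = \<Sum>_j <Y, E_j> E_j and apply the product rule: the terms that differentiate
  a coefficient are multiples of the E_j, hence tangent, and the normal projection kills them. Only
  the value of Y at p remains.\<close>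

lemma second_fundamental_form_tensorial:
  assumes E: "orthonormal_frame_on M U E" "p \<in> U" and Y: "tangent_field_on M U Y"
    and v: "X p \<in> tangent_space M p"
  shows "second_fundamental_form M X Y p =
    (\<Sum>j<DIM('m). (Y p \<bullet> E j p) *\<^sub>R orth_proj (normal_space M p) (mderiv M (E j) p (X p)))"
proof -
  note D = orthonormal_frame_onD[OF E(1)]
  note p = D(5)[OF E(2)]
  note lin = orth_proj_normal(3)[OF p]
  have dE: "mdiff (E j) p" if "j < DIM('m)" for j
    using tangent_field_on_mdiff[OF D(2)[OF that] E(2)] .
  have dYE: "mdiff (\<lambda>q. Y q \<bullet> E j q) p" if "j < DIM('m)" for j
    using mdiff_inner(1)[OF tangent_field_on_mdiff[OF Y E(2)] dE[OF that]] .
  have summand: "mdiff (\<lambda>q. (Y q \<bullet> E j q) *\<^sub>R E j q) p" if "j < DIM('m)" for j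
    using mdiff_scaleR(1)[OF dYE[OF that] dE[OF that]] .
  have "mdiff (\<lambda>q. \<Sum>j<DIM('m). (Y q \<bullet> E j q) *\<^sub>R E j q) p"
    by (rule mdiff_sum(1)[OF p]) (simp add: summand)
  then have "mderiv M Y p (X p) = mderiv M (\<lambda>q. \<Sum>j<DIM('m). (Y q \<bullet> E j q) *\<^sub>R E j q) p (X p)"
    using frame_expansion[OF E(1)] tangent_field_onD(3)[OF Y]
    by (intro mdiff_cong(2)[OF _ D(1) E(2) _ v]) (auto simp flip: frame_expansion[OF E(1)])
  also have "\<dots> = (\<Sum>j<DIM('m). mderiv M (\<lambda>q. (Y q \<bullet> E j q) *\<^sub>R E j q) p (X p))"
    by (rule mdiff_sum(2)[OF p _ v]) (simp add: summand)
  also have "\<dots> = (\<Sum>j<DIM('m). (Y p \<bullet> E j p) *\<^sub>R mderiv M (E j) p (X p) +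
      mderiv M (\<lambda>q. Y q \<bullet> E j q) p (X p) *\<^sub>R E j p)"
    by (intro sum.cong refl mdiff_scaleR(2) dYE dE v) auto
  finally show ?thesis
    by (simp add: second_fundamental_form_eq[OF p] linear_sum[OF lin] linear_add[OF lin]
        linear_scale[OF lin] orth_proj_normal(4)[OF p D(3)[OF E(2)]])
qed

text \<open>By definition, the trace at each point uses its own chosen frame. Replacing it by a
  given smooth frame is what makes \<open>mean_curvature\<close> smooth.\<close>

lemma trace_second_fundamental_form:
  assumes E: "orthonormal_frame_on M U E" "p \<in> U"
  shows "trace_at M (second_fundamental_form M) p = (\<Sum>i<DIM('m). second_fundamental_form M (E i) (E i) p)"
proof -
  note D = orthonormal_frame_onD[OF E(1)]
  note p = D(5)[OF E(2)]
  note lin = orth_proj_normal(3)[OF p]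
  define b where "b v w = (\<Sum>j<DIM('m). (w \<bullet> E j p) *\<^sub>R orth_proj (normal_space M p) (mderiv M (E j) p v))"
    for v w
  have dE: "mdiff (E j) p" if "j < DIM('m)" for j
    using tangent_field_on_mdiff[OF D(2)[OF that] E(2)] .
  obtain E' U' where E': "p \<in> U'" "orthonormal_frame_on M U' E'"
    and tr: "trace_at M (second_fundamental_form M) p = (\<Sum>i<DIM('m). second_fundamental_form M (E' i) (E' i) p)"
    using trace_at_frame(1)[OF p, where F = "second_fundamental_form M"] trace_at_frame(2)[OF p] by blast
  note D' = orthonormal_frame_onD[OF E'(2)]
  \<comment> \<open>Tensoriality is stated for a frame and a field on the same open set, so both
    frames are restricted to the intersection.\<close>
  have W: "openin (mtop M) (U \<inter> U')" "p \<in> U \<inter> U'"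
    using D(1) D'(1) E(2) E'(1) by auto
  have EW: "orthonormal_frame_on M (U \<inter> U') E"
    using E(1) tangent_field_on_subset[OF _ W(1)] by (auto simp: orthonormal_frame_on_def)
  have B: "second_fundamental_form M X Y p = b (X p) (Y p)"
    if "tangent_field_on M (U \<inter> U') Y" "X p \<in> tangent_space M p" for X Y
    unfolding b_def by (rule second_fundamental_form_tensorial[where X = X, OF EW W(2) that])
  have "(\<Sum>i<DIM('m). b (E' i p) (E' i p)) = (\<Sum>i<DIM('m). b (E i p) (E i p))"
  proof (rule trace_independent_of_frame[where b = b, OF E E'(2,1)])
    fix c w
    have "mderiv M (E j) p (\<Sum>i<DIM('m). c i *\<^sub>R E i p) = (\<Sum>i<DIM('m). c i *\<^sub>R mderiv M (E j) p (E i p))"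
      if "j < DIM('m)" for j
      by (rule mderiv_sum_vector[OF _ dE[OF that]]) (simp add: D(3)[OF E(2)])
    then have "b (\<Sum>i<DIM('m). c i *\<^sub>R E i p) w = (\<Sum>j<DIM('m). \<Sum>i<DIM('m).
        c i *\<^sub>R (w \<bullet> E j p) *\<^sub>R orth_proj (normal_space M p) (mderiv M (E j) p (E i p)))"
      by (simp add: b_def linear_sum[OF lin] linear_scale[OF lin] scaleR_sum_right mult.commute)
    also have "\<dots> = (\<Sum>i<DIM('m). c i *\<^sub>R b (E i p) w)"
      by (subst sum.swap) (simp add: b_def scaleR_sum_right)
    finally show "b (\<Sum>i<DIM('m). c i *\<^sub>R E i p) w = (\<Sum>i<DIM('m). c i *\<^sub>R b (E i p) w)" .
  next
    fix c v
    have "b v (\<Sum>i<DIM('m). c i *\<^sub>R E i p) = (\<Sum>j<DIM('m). \<Sum>i<DIM('m).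
        c i *\<^sub>R (E i p \<bullet> E j p) *\<^sub>R orth_proj (normal_space M p) (mderiv M (E j) p v))"
      by (simp add: b_def inner_sum_left scaleR_sum_left)
    also have "\<dots> = (\<Sum>i<DIM('m). c i *\<^sub>R b v (E i p))"
      by (subst sum.swap) (simp add: b_def scaleR_sum_right)
    finally show "b v (\<Sum>i<DIM('m). c i *\<^sub>R E i p) = (\<Sum>i<DIM('m). c i *\<^sub>R b v (E i p))" .
  qed
  moreover have "second_fundamental_form M (E i) (E i) p = b (E i p) (E i p)" if "i < DIM('m)" for i
    using that by (intro B tangent_field_on_subset[OF D(2) W(1)] D(3)[OF E(2)]) auto
  moreover have "second_fundamental_form M (E' i) (E' i) p = b (E' i p) (E' i p)" if "i < DIM('m)" for i
    using that by (intro B tangent_field_on_subset[OF D'(2) W(1)] D'(3)[OF E'(1)]) auto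
  ultimately show ?thesis using tr by simp
qed

lemma mean_curvature_frame:
  assumes "orthonormal_frame_on M U E" "p \<in> U"
  shows "mean_curvature M p =
    (1 / real DIM('m)) *\<^sub>R (\<Sum>i<DIM('m). second_fundamental_form M (E i) (E i) p)"
  by (simp add: mean_curvature_def trace_second_fundamental_form[OF assms])

lemma smooth_second_fundamental_form:
  assumes E: "orthonormal_frame_on M U E" and X: "tangent_field_on M U X" and Y: "tangent_field_on M U Y"
  shows "smooth_fun_on M U (second_fundamental_form M X Y)"
proof -
  note D = orthonormal_frame_onD[OF E]
  let ?d = "\<lambda>q. mderiv M Y q (X q)"
  have d: "smooth_fun_on M U ?d"
    by (rule smooth_fun_on_mderiv[OF X tangent_field_onD(2)[OF Y]])
  have imm: "smooth_fun_on M U (imm M)"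
    using smooth_fun_on_subset[OF imm_smooth openin_subset[OF D(1)]] .
  show ?thesis
  proof (rule smooth_fun_on_cong[OF D(1)])
    show "smooth_fun_on M U (\<lambda>q. ?d q - (?d q \<bullet> imm M q) *\<^sub>R imm M q - (\<Sum>i<DIM('m). (?d q \<bullet> E i q) *\<^sub>R E i q))"
      by (intro smooth_fun_on_diff smooth_fun_on_sum smooth_fun_on_scaleR smooth_fun_on_inner D(1) d imm
          tangent_field_onD(2)[OF D(2)]) auto
  qed (simp add: second_fundamental_form_eq D(5) orth_proj_normal_eq orth_proj_tangent_frame[OF E])
qed

lemma tangent_field_levi_civita:
  assumes E: "orthonormal_frame_on M U E" and X: "tangent_field_on M U X" and Y: "tangent_field_on M U Y"
  shows "tangent_field_on M U (levi_civita M X Y)"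
  unfolding tangent_field_on_def
proof (intro conjI ballI)
  note D = orthonormal_frame_onD[OF E]
  show "openin (mtop M) U" by (rule D(1))
  show "levi_civita M X Y q \<in> tangent_space M q" if "q \<in> U" for q
    by (rule levi_civita_tangent[OF D(5)[OF that]])
  show "smooth_fun_on M U (levi_civita M X Y)"
  proof (rule smooth_fun_on_cong[OF D(1)])
    show "smooth_fun_on M U (\<lambda>q. \<Sum>i<DIM('m). (mderiv M Y q (X q) \<bullet> E i q) *\<^sub>R E i q)"
      by (intro smooth_fun_on_sum smooth_fun_on_scaleR smooth_fun_on_inner D(1)
          smooth_fun_on_mderiv[OF X tangent_field_onD(2)[OF Y]] tangent_field_onD(2)[OF D(2)]) auto
  qed (simp add: levi_civita_eq D(5) orth_proj_tangent_frame[OF E])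
qed

lemma smooth_mean_curvature:
  assumes E: "orthonormal_frame_on M U E"
  shows "smooth_fun_on M U (mean_curvature M)"
proof -
  note D = orthonormal_frame_onD[OF E]
  have "smooth_fun_on M U (\<lambda>q. (1 / real DIM('m)) *\<^sub>R (\<Sum>i<DIM('m). second_fundamental_form M (E i) (E i) q))"
    by (intro smooth_fun_on_scaleR smooth_fun_on_sum smooth_fun_on_const D(1)
        smooth_second_fundamental_form[OF E] D(2)) auto
  then show ?thesis
    by (rule smooth_fun_on_cong[OF D(1)]) (simp add: mean_curvature_frame[OF E])
qed

lemma mdiff_mean_curvature:
  assumes "p \<in> topspace (mtop M)"
  shows "mdiff (mean_curvature M) p"
proof -
  obtain E U where "p \<in> U" "orthonormal_frame_on M U E"
    using orthonormal_frame_exists[OF assms] by blast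
  then show ?thesis
    using smooth_fun_on_mdiff[OF orthonormal_frame_onD(1) smooth_mean_curvature] by blast
qed

lemma mean_curvature_normal:
  assumes p: "p \<in> topspace (mtop M)"
  shows "mean_curvature M p \<in> normal_space M p"
proof -
  obtain E U where "p \<in> U" "orthonormal_frame_on M U E"
    using orthonormal_frame_exists[OF p] by blast
  then show ?thesis
    by (auto simp: mean_curvature_frame
        intro!: subspace_scale subspace_sum subspace_normal_space second_fundamental_form_normal p)
qed

text \<open>The differential of the immersion fixes tangent vectors, so its Hessian is the sphere's
  covariant derivative minus that of M. By the Gauss formula this is the second fundamental form,
  whose trace is m H.\<close>

lemma tension_field_eq:
  assumes p: "p \<in> topspace (mtop M)"
  shows "tension_field M (imm M) p = real DIM('m) *\<^sub>R mean_curvature M p"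
proof -
  have "nabla_dmap M (imm M) X Y p = second_fundamental_form M X Y p"
    if X: "tangent_field_on M U X" and Y: "tangent_field_on M U Y" and pU: "p \<in> U" for X Y U
  proof -
    note D = tangent_field_onD[OF Y]
    have "mderiv M (dmap M (imm M) Y) p (X p) = mderiv M Y p (X p)"
      by (rule mdiff_cong(2)[OF tangent_field_on_mdiff[OF Y pU] D(1) pU _ tangent_field_onD(3)[OF X pU]])
        (simp add: dmap_def mderiv_imm D(3,4))
    then show ?thesis
      by (simp add: nabla_dmap_def pullback_conn_def dmap_def mderiv_imm p levi_civita_tangent
          second_fundamental_form_eq orth_proj_normal_eq)
        (simp add: levi_civita_eq[OF p] orth_proj_sphere[OF p])
  qed
  then have "nabla_dmap M (imm M) (E i) (E i) p = second_fundamental_form M (E i) (E i) p"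
    if "orthonormal_frame_on M U E" "p \<in> U" "i < DIM('m)" for E U i
    using orthonormal_frame_onD(2)[OF that(1,3)] that(2) by blast
  then have "tension_field M (imm M) p = trace_at M (second_fundamental_form M) p"
    using trace_at_frame(2)[OF p] unfolding tension_field_def trace_at_frame(1)[OF p]
    by (intro sum.cong) auto
  then show ?thesis by (simp add: mean_curvature_def)
qed

text \<open>On a ball in a chart domain, which is convex, a vanishing derivative makes f constant;
  connectedness of M turns local constancy into global constancy.\<close>

lemma zero_derivative_constant:
  fixes f :: "'a \<Rightarrow> real"
  assumes "\<And>p. p \<in> topspace (mtop M) \<Longrightarrow> mdiff f p"
    and "\<And>p v. p \<in> topspace (mtop M) \<Longrightarrow> v \<in> tangent_space M p \<Longrightarrow> mderiv M f p v = 0"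
  shows "\<exists>c. \<forall>p\<in>topspace (mtop M). f p = c"
proof (cases "topspace (mtop M) = {}")
  case False
  then obtain p0 where p0: "p0 \<in> topspace (mtop M)" by blast
  have loc: "\<exists>W. openin (mtop M) W \<and> p \<in> W \<and> (\<forall>q\<in>W. f q = f p)" if p: "p \<in> topspace (mtop M)" for p
  proof -
    obtain V x u where x: "(V, x) \<in> atlas M" "u \<in> V" "p = x u"
      using chart_around[OF p] .
    obtain r where r: "r > 0" "ball u r \<subseteq> V"
      using chart_open[OF x(1)] x(2) open_contains_ball by blast
    have d: "((\<lambda>u. f (x u)) has_derivative (\<lambda>w. 0)) (at v)" if v: "v \<in> ball u r" for v
    proof -
      have vV: "v \<in> V" using v r by auto
      note q = chart_in_topspace[OF x(1) vV]
      have "frechet_derivative (\<lambda>u. f (x u)) (at v) w = 0" for w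
        using mderiv_chart[OF x(1) vV assms(1)[OF q], of w] assms(2)[OF q]
          tangent_space_chart[OF x(1) vV] by auto
      then have "frechet_derivative (\<lambda>u. f (x u)) (at v) = (\<lambda>w. 0)" by blast
      then show ?thesis
        using mdiffD[OF x(1) vV assms(1)[OF q]] unfolding frechet_derivative_works by simp
    qed
    have "f (x v) = f (x u)" if "v \<in> ball u r" for v
      by (rule has_derivative_zero_unique[OF convex_ball has_derivative_at_withinI[OF d] that]) (simp_all add: r(1))
    then have "\<forall>q\<in>x ` ball u r. f q = f p" using x(3) by auto
    moreover have "openin (mtop M) (x ` ball u r)"
      by (rule chart_image_open[OF x(1) open_ball r(2)])
    moreover have "p \<in> x ` ball u r"
      unfolding x(3) by (rule imageI) (simp add: r(1))
    ultimately show ?thesis by blast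
  qed
  let ?A = "{q \<in> topspace (mtop M). f q = f p0}"
  \<comment> \<open>Stated for any predicate \<open>P\<close> on the value, so that it yields
    openness of the level set and of its complement alike.\<close>
  have clopen: "openin (mtop M) {q \<in> topspace (mtop M). P (f q)}" for P
  proof (subst openin_subopen, intro ballI)
    fix q assume q: "q \<in> {q \<in> topspace (mtop M). P (f q)}"
    then have "q \<in> topspace (mtop M)" by simp
    from loc[OF this] obtain W where W: "openin (mtop M) W" "q \<in> W" "\<forall>q'\<in>W. f q' = f q"
      by blast
    have "W \<subseteq> {q \<in> topspace (mtop M). P (f q)}"
    proof
      fix q' assume "q' \<in> W"
      then have "q' \<in> topspace (mtop M)" "f q' = f q" using openin_subset[OF W(1)] W(3) by blast+
      then show "q' \<in> {q \<in> topspace (mtop M). P (f q)}" using q by simp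
    qed
    then show "\<exists>W. openin (mtop M) W \<and> q \<in> W \<and> W \<subseteq> {q \<in> topspace (mtop M). P (f q)}"
      using W by blast
  qed
  have "openin (mtop M) ?A" by (rule clopen)
  moreover have "topspace (mtop M) - ?A = {q \<in> topspace (mtop M). f q \<noteq> f p0}" by auto
  then have "openin (mtop M) (topspace (mtop M) - ?A)" using clopen[of "\<lambda>t. t \<noteq> f p0"] by simp
  ultimately have "openin (mtop M) ?A \<and> closedin (mtop M) ?A"
    by (simp add: closedin_def)
  moreover have "connected_space (mtop M)"
    using manifold by (simp add: smooth_manifold_def)
  ultimately have "?A = {} \<or> ?A = topspace (mtop M)"
    unfolding connected_space_clopen_in by blast
  then show ?thesis using p0 by blast
qed auto

text \<open>Differentiating <f, H> = 0 moves the derivative from f to H. It is applied to the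
  immersion, to tangent fields and to A_H E_i.\<close>

lemma mean_curvature_inner_mderiv:
  assumes p: "p \<in> topspace (mtop M)" and W: "openin (mtop M) W" "p \<in> W"
    and f: "mdiff f p" "\<And>q. q \<in> W \<Longrightarrow> f q \<bullet> mean_curvature M q = 0" and v: "v \<in> tangent_space M p"
  shows "mderiv M f p v \<bullet> mean_curvature M p = - (f p \<bullet> mderiv M (mean_curvature M) p v)"
proof -
  note H = mdiff_mean_curvature[OF p]
  have "mderiv M (\<lambda>q. f q \<bullet> mean_curvature M q) p v = mderiv M (\<lambda>q. 0) p v"
    by (rule mdiff_cong(2)[OF mdiff_const[OF p] W _ v]) (simp add: f(2))
  then show ?thesis
    using mdiff_inner(2)[OF f(1) H v] by (simp add: mderiv_const[OF p v])
qed

end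

section \<open>Parallel mean curvature\<close>

locale parallel_immersion = sphere_immersion M
  for M :: "('a, 'm::euclidean_space, 'e::euclidean_space) mapped_manifold" +
  assumes parallel: "parallel_mean_curvature M"
begin

abbreviation "H \<equiv> mean_curvature M"

text \<open>The radial part of D_v H is -<H, v> = 0, and parallelism removes the normal part.
  Parallelism is expressed through fields, so this is first done for the vectors of a frame and then
  extended by linearity.\<close>

lemma mderiv_mean_curvature_tangent:
  assumes p: "p \<in> topspace (mtop M)" and v: "v \<in> tangent_space M p"
  shows "mderiv M H p v \<in> tangent_space M p"
proof -
  obtain E U where E: "p \<in> U" "orthonormal_frame_on M U E"
    using orthonormal_frame_exists[OF p] by blast
  note D = orthonormal_frame_onD[OF E(2)]
  have "mderiv M H p (E i p) \<in> tangent_space M p" if i: "i < DIM('m)" for i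
  proof -
    let ?d = "mderiv M H p (E i p)"
    have Ei: "E i p \<in> tangent_space M p" by (rule D(3)[OF E(1) i])
    have "imm M q \<bullet> H q = 0" if "q \<in> topspace (mtop M)" for q
      by (rule normal_spaceD(2)[OF mean_curvature_normal[OF that]])
    from mean_curvature_inner_mderiv[OF p openin_topspace p mdiff_imm[OF p] this Ei]
    have 1: "?d \<bullet> imm M p = 0"
      using normal_spaceD(4)[OF mean_curvature_normal[OF p] Ei]
      by (simp add: mderiv_imm[OF p Ei] inner_commute)
    have "orth_proj (normal_space M p) ?d = 0"
      using parallel D(2)[OF i] E(1) normal_conn_eq[OF p, of "E i" H]
      unfolding parallel_mean_curvature_def by metis
    then have "?d = orth_proj (tangent_space M p) ?d"
      using 1 by (simp add: orth_proj_normal_eq[OF p])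
    then show ?thesis using orth_proj_tangent(1)[OF p] by metis
  qed
  moreover have "mderiv M H p v = mderiv M H p (\<Sum>i<DIM('m). (v \<bullet> E i p) *\<^sub>R E i p)"
    using frame_expansion[OF E(2,1) v] by simp
  moreover have "\<dots> = (\<Sum>i<DIM('m). (v \<bullet> E i p) *\<^sub>R mderiv M H p (E i p))"
    by (rule mderiv_sum_vector[OF _ mdiff_mean_curvature[OF p]]) (simp add: D(3)[OF E(1)])
  ultimately show ?thesis
    by (auto intro!: subspace_sum subspace_scale subspace_tangent_space p)
qed

text \<open>Differentiate <Y, H> = 0; projecting to the normal space does not change the pairing
  with H.\<close>

lemma second_fundamental_form_inner_mean_curvature:
  assumes Y: "tangent_field_on M U Y" "p \<in> U" and X: "X p \<in> tangent_space M p"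
  shows "second_fundamental_form M X Y p \<bullet> H p = - (mderiv M H p (X p) \<bullet> Y p)"
proof -
  note D = tangent_field_onD[OF Y(1)]
  note p = D(4)[OF Y(2)]
  have "Y q \<bullet> H q = 0" if "q \<in> U" for q
    by (rule normal_spaceD(4)[OF mean_curvature_normal[OF D(4)[OF that]] D(3)[OF that]])
  from mean_curvature_inner_mderiv[OF p D(1) Y(2) tangent_field_on_mdiff[OF Y] this X]
  show ?thesis
    by (simp add: second_fundamental_form_eq[OF p] orth_proj_normal(2)[OF p mean_curvature_normal[OF p]]
        inner_commute[of "Y p"])
qed

text \<open>Testing against the fields of a frame shows that the description in
  \<open>weingarten\<close> has one solution. Smoothness of A_H X, and its linearity in the value of
  X, then come from \<open>mderiv\<close>.\<close>

lemma weingarten_mean_curvature: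
  assumes p: "p \<in> topspace (mtop M)" and X: "X p \<in> tangent_space M p"
  shows "weingarten M H X p = - mderiv M H p (X p)"
  unfolding weingarten_def
proof (rule the_equality)
  have d: "- mderiv M H p (X p) \<in> tangent_space M p"
    by (intro subspace_neg subspace_tangent_space mderiv_mean_curvature_tangent p X)
  then show "- mderiv M H p (X p) \<in> tangent_space M p \<and> (\<forall>U Y. p \<in> U \<and> tangent_field_on M U Y \<longrightarrow>
      - mderiv M H p (X p) \<bullet> Y p = second_fundamental_form M X Y p \<bullet> H p)"
    using second_fundamental_form_inner_mean_curvature[where X = X, OF _ _ X] by auto
  fix z assume z: "z \<in> tangent_space M p \<and> (\<forall>U Y. p \<in> U \<and> tangent_field_on M U Y \<longrightarrow>
      z \<bullet> Y p = second_fundamental_form M X Y p \<bullet> H p)"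
  obtain E U where E: "p \<in> U" "orthonormal_frame_on M U E"
    using orthonormal_frame_exists[OF p] by blast
  note D = orthonormal_frame_onD[OF E(2)]
  have coeff: "z \<bullet> E i p = - mderiv M H p (X p) \<bullet> E i p" if "i < DIM('m)" for i
  proof -
    have "z \<bullet> E i p = second_fundamental_form M X (E i) p \<bullet> H p"
      using z D(2)[OF that] E(1) by blast
    then show ?thesis
      using second_fundamental_form_inner_mean_curvature[where X = X, OF D(2)[OF that] E(1) X] by simp
  qed
  have "z = (\<Sum>i<DIM('m). (z \<bullet> E i p) *\<^sub>R E i p)"
    using frame_expansion[OF E(2,1)] z by blast
  also have "\<dots> = (\<Sum>i<DIM('m). (- mderiv M H p (X p) \<bullet> E i p) *\<^sub>R E i p)"
    by (intro sum.cong refl) (simp only: coeff lessThan_iff)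
  also have "\<dots> = - mderiv M H p (X p)"
    by (rule frame_expansion[OF E(2,1) d, symmetric])
  finally show "z = - mderiv M H p (X p)" .
qed

lemma weingarten_tangent:
  assumes "p \<in> topspace (mtop M)" "X p \<in> tangent_space M p"
  shows "weingarten M H X p \<in> tangent_space M p"
  by (simp add: weingarten_mean_curvature[of p X] assms subspace_neg subspace_tangent_space
      mderiv_mean_curvature_tangent)

lemma tangent_field_weingarten:
  assumes E: "orthonormal_frame_on M U E" and X: "tangent_field_on M U X"
  shows "tangent_field_on M U (weingarten M H X)"
proof -
  note D = tangent_field_onD[OF X]
  have "smooth_fun_on M U (weingarten M H X)"
  proof (rule smooth_fun_on_cong[OF D(1)])
    show "smooth_fun_on M U (\<lambda>q. - mderiv M H q (X q))"
      by (intro smooth_fun_on_minus D(1) smooth_fun_on_mderiv[OF X smooth_mean_curvature[OF E]])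
  qed (simp add: weingarten_mean_curvature D)
  then show ?thesis
    using D by (simp add: tangent_field_on_def weingarten_tangent)
qed

text \<open>The derivative of <H, H> pairs the tangent vector D_v H with the normal vector
  H.\<close>

lemma mean_curvature_norm_constant: "\<exists>c. \<forall>p\<in>topspace (mtop M). H p \<bullet> H p = c"
proof (rule zero_derivative_constant)
  fix p assume p: "p \<in> topspace (mtop M)"
  note H = mdiff_mean_curvature[OF p]
  show "mdiff (\<lambda>p. H p \<bullet> H p) p" by (rule mdiff_inner(1)[OF H H])
  fix v assume v: "v \<in> tangent_space M p"
  show "mderiv M (\<lambda>p. H p \<bullet> H p) p v = 0"
    using normal_spaceD(3,4)[OF mean_curvature_normal[OF p] mderiv_mean_curvature_tangent[OF p v]]
    by (simp add: mdiff_inner(2)[OF H H v])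
qed

text \<open>The norm is going to be differentiated along X, which requires one frame on a whole
  neighbourhood in place of the pointwise choice.\<close>

lemma weingarten_norm2_frame:
  assumes E: "orthonormal_frame_on M U E" "p \<in> U"
  shows "weingarten_norm2 M H p = (\<Sum>i<DIM('m). weingarten M H (E i) p \<bullet> weingarten M H (E i) p)"
proof -
  note D = orthonormal_frame_onD[OF E(1)]
  note p = D(5)[OF E(2)]
  note H = mdiff_mean_curvature[OF p]
  define b where "b v w = mderiv M H p v \<bullet> mderiv M H p w" for v w
  obtain E' U' where E': "p \<in> U'" "orthonormal_frame_on M U' E'"
    and tr: "weingarten_norm2 M H p = (\<Sum>i<DIM('m). weingarten M H (E' i) p \<bullet> weingarten M H (E' i) p)"
    using trace_at_frame(1)[OF p, where F = "\<lambda>X Y q. weingarten M H X q \<bullet> weingarten M H Y q"]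
      trace_at_frame(2)[OF p] unfolding weingarten_norm2_def by blast
  note D' = orthonormal_frame_onD[OF E'(2)]
  have lin: "mderiv M H p (\<Sum>i<DIM('m). c i *\<^sub>R E i p) = (\<Sum>i<DIM('m). c i *\<^sub>R mderiv M H p (E i p))" for c
    by (rule mderiv_sum_vector[OF _ H]) (simp add: D(3)[OF E(2)])
  have "(\<Sum>i<DIM('m). b (E' i p) (E' i p)) = (\<Sum>i<DIM('m). b (E i p) (E i p))"
    by (rule trace_independent_of_frame[where b = b, OF E E'(2,1)])
      (simp_all add: b_def lin inner_sum_left inner_sum_right)
  then show ?thesis
    using tr by (simp add: b_def weingarten_mean_curvature[OF p] D(3)[OF E(2)] D'(3)[OF E'(1)])
qed

text \<open>With A_H = - D H, the derivative (\<nabla>_X A_H) Y is - P (D_X D_Y H) + D_Z H, where P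
  is the tangential projection and Z = P (D_X Y). Antisymmetrized in X and Y this becomes - P (D_b
  H) + D_(P b) H for the bracket b. Both b and D_b H are tangent, so P fixes them and the terms
  cancel.\<close>

lemma nabla_weingarten_codazzi:
  assumes E: "orthonormal_frame_on M U E" and X: "tangent_field_on M U X" and Y: "tangent_field_on M U Y"
    and pU: "p \<in> U"
  shows "nabla_weingarten M H X Y p = nabla_weingarten M H Y X p"
proof -
  note U = tangent_field_onD(1)[OF X]
  note p = tangent_field_onD(4)[OF X pU]
  note H = smooth_mean_curvature[OF E]
  note P = orth_proj_tangent[OF p]
  let ?P = "orth_proj (tangent_space M p)"
  have nabla: "nabla_weingarten M H X Y p =
      - ?P (mderiv M (\<lambda>q. mderiv M H q (Y q)) p (X p)) + mderiv M H p (?P (mderiv M Y p (X p)))"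
    if X: "tangent_field_on M U X" and Y: "tangent_field_on M U Y" for X Y
  proof -
    let ?f = "\<lambda>q. mderiv M H q (Y q)"
    have f: "mdiff ?f p" by (rule smooth_fun_on_mdiff[OF U smooth_fun_on_mderiv[OF Y H] pU])
    note Xp = tangent_field_onD(3)[OF X pU]
    have "mderiv M (weingarten M H Y) p (X p) = mderiv M (\<lambda>q. - ?f q) p (X p)"
      by (rule mdiff_cong(2)[OF mdiff_minus(1)[OF f] U pU _ Xp])
        (simp add: weingarten_mean_curvature tangent_field_onD[OF Y])
    also have "\<dots> = - mderiv M ?f p (X p)" by (rule mdiff_minus(2)[OF f Xp])
    finally show ?thesis
      by (simp add: nabla_weingarten_def levi_civita_eq[OF p] linear_neg[OF P(3)]
          weingarten_mean_curvature[OF p] P(1))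
  qed
  let ?b = "mderiv M Y p (X p) - mderiv M X p (Y p)"
  note comm = mderiv_commutator[OF X Y H pU]
  have "?P (mderiv M (\<lambda>q. mderiv M H q (Y q)) p (X p)) - ?P (mderiv M (\<lambda>q. mderiv M H q (X q)) p (Y p)) =
      ?P (mderiv M H p ?b)"
    by (simp only: linear_diff[OF P(3), symmetric] comm(2))
  also have "\<dots> = mderiv M H p (?P ?b)"
    by (simp add: P(4) comm(1) mderiv_mean_curvature_tangent[OF p])
  also have "\<dots> = mderiv M H p (?P (mderiv M Y p (X p))) - mderiv M H p (?P (mderiv M X p (Y p)))"
    by (simp only: linear_diff[OF P(3)] mderiv_diff_vector[OF P(1) P(1) mdiff_mean_curvature[OF p]])
  finally show ?thesis
    unfolding nabla[OF X Y] nabla[OF Y X] by (simp add: algebra_simps)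
qed

text \<open>Differentiate <B(Y, Z), H> = <A_H Y, Z> along X. On the left, D_X H is tangent and so
  does not meet the normal vector B(Y, Z). On the right, <A_H Y, D_X Z> cancels against <B(Y,
  \<nabla>_X Z), H>.\<close>

lemma nabla_second_fundamental_form_inner_mean_curvature:
  assumes E: "orthonormal_frame_on M U E" and X: "tangent_field_on M U X" and Y: "tangent_field_on M U Y"
    and Z: "tangent_field_on M U Z" and pU: "p \<in> U"
  shows "nabla_second_fundamental_form M X Y Z p \<bullet> H p = nabla_weingarten M H X Y p \<bullet> Z p"
proof -
  note U = tangent_field_onD(1)[OF X]
  note p = tangent_field_onD(4)[OF X pU]
  note Xp = tangent_field_onD(3)[OF X pU] and Yp = tangent_field_onD(3)[OF Y pU]
    and Zp = tangent_field_onD(3)[OF Z pU]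
  note H = mdiff_mean_curvature[OF p]
  note N = mean_curvature_normal[OF p]
  note P = orth_proj_tangent[OF p]
  let ?B = "second_fundamental_form M Y Z" and ?A = "weingarten M H Y"
  have B: "mdiff ?B p"
    by (rule smooth_fun_on_mdiff[OF U smooth_second_fundamental_form[OF E Y Z] pU])
  have A: "mdiff ?A p" "?A p \<in> tangent_space M p"
    using tangent_field_weingarten[OF E Y] pU tangent_field_on_mdiff tangent_field_onD(3) by blast+
  note Z' = tangent_field_on_mdiff[OF Z pU]
  have "mderiv M (\<lambda>q. ?B q \<bullet> H q) p (X p) = mderiv M (\<lambda>q. ?A q \<bullet> Z q) p (X p)"
  proof (rule mdiff_cong(2)[OF mdiff_inner(1)[OF A(1) Z'] U pU _ Xp])
    fix q assume q: "q \<in> U"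
    show "?A q \<bullet> Z q = ?B q \<bullet> H q"
      using second_fundamental_form_inner_mean_curvature[where X = Y, OF Z q tangent_field_onD(3)[OF Y q]]
        weingarten_mean_curvature[where X = Y, OF tangent_field_onD(4)[OF Y q] tangent_field_onD(3)[OF Y q]]
      by simp
  qed
  then have "mderiv M ?B p (X p) \<bullet> H p = ?A p \<bullet> mderiv M Z p (X p) + mderiv M ?A p (X p) \<bullet> Z p"
    using normal_spaceD(3)[OF second_fundamental_form_normal[OF p] mderiv_mean_curvature_tangent[OF p Xp]]
    by (simp add: mdiff_inner(2)[OF B H Xp] mdiff_inner(2)[OF A(1) Z' Xp])
  moreover have "second_fundamental_form M (levi_civita M X Y) Z p \<bullet> H p =
      weingarten M H (levi_civita M X Y) p \<bullet> Z p"
    by (simp add: second_fundamental_form_inner_mean_curvature[OF Z pU] levi_civita_tangent[OF p]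
        weingarten_mean_curvature[OF p])
  moreover have "second_fundamental_form M Y (levi_civita M X Z) p \<bullet> H p = ?A p \<bullet> mderiv M Z p (X p)"
    using second_fundamental_form_inner_mean_curvature[where X = Y, OF tangent_field_levi_civita[OF E X Z] pU Yp]
      weingarten_mean_curvature[where X = Y, OF p Yp] P(2)[OF A(2), of "mderiv M Z p (X p)"]
    by (simp add: levi_civita_eq[OF p] inner_commute)
  moreover have "levi_civita M X ?A p \<bullet> Z p = mderiv M ?A p (X p) \<bullet> Z p"
    by (simp add: levi_civita_eq[OF p] P(2)[OF Zp])
  ultimately show ?thesis
    by (simp add: nabla_second_fundamental_form_def nabla_weingarten_def normal_conn_eq[OF p]
        orth_proj_normal(2)[OF p N] inner_diff_left)
qed

section \<open>The biharmonic equation\<close>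

text \<open>The sphere's covariant derivative of A_H E_i is kept unsplit here. Its tangential part
  and its pairing with H are extracted separately afterwards.\<close>

lemma biharmonic_equation:
  assumes bih: "biharmonic_map M (imm M)" and p: "p \<in> topspace (mtop M)"
  defines "E \<equiv> SOME E. \<exists>U. p \<in> U \<and> orthonormal_frame_on M U E"
  shows "(\<Sum>i<DIM('m). orth_proj (sphere_tangent (imm M p)) (mderiv M (weingarten M H (E i)) p (E i p))
      - weingarten M H (levi_civita M (E i) (E i)) p) = real DIM('m) *\<^sub>R H p"
proof -
  let ?m = "real DIM('m)" and ?S = "\<lambda>q. orth_proj (sphere_tangent (imm M q))"
    and ?\<tau> = "tension_field M (imm M)"
  have "\<exists>U. p \<in> U \<and> orthonormal_frame_on M U E"
    unfolding E_def by (rule trace_at_frame(2)[OF p])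
  then obtain U where U: "p \<in> U" "orthonormal_frame_on M U E" by blast
  note D = orthonormal_frame_onD[OF U(2)]
  note tr = trace_at_frame(1)[OF p, folded E_def]
  have \<tau>: "mderiv M ?\<tau> q v = ?m *\<^sub>R mderiv M H q v"
    if q: "q \<in> topspace (mtop M)" and v: "v \<in> tangent_space M q" for q v
  proof -
    note H = mdiff_mean_curvature[OF q]
    have "mderiv M ?\<tau> q v = mderiv M (\<lambda>q. ?m *\<^sub>R H q) q v"
      by (rule mdiff_cong(2)[OF mdiff_scaleR_const(1)[OF H] openin_topspace q _ v]) (simp add: tension_field_eq)
    then show ?thesis by (simp add: mdiff_scaleR_const(2)[OF H v])
  qed
  have second: "pullback_conn M (imm M) (E i) (pullback_conn M (imm M) (E i) ?\<tau>) p =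
      - ?m *\<^sub>R ?S p (mderiv M (weingarten M H (E i)) p (E i p))"
    and first: "pullback_conn M (imm M) (levi_civita M (E i) (E i)) ?\<tau> p =
      - ?m *\<^sub>R weingarten M H (levi_civita M (E i) (E i)) p"
    and curv: "sphere_curvature (imm M p) (dmap M (imm M) (E i) p) (?\<tau> p) (dmap M (imm M) (E i) p) =
      - ?m *\<^sub>R H p"
    if i: "i < DIM('m)" for i
  proof -
    let ?A = "weingarten M H (E i)"
    note A = tangent_field_on_mdiff[OF tangent_field_weingarten[OF U(2) D(2)[OF i]] U(1)]
    note Ei = D(3)[OF U(1) i]
    \<comment> \<open>The first covariant derivative of the tension field equals - m A_H E_i on all
      of \<open>U\<close> and not just at p, which permits differentiating once more.\<close>
    have "mderiv M (pullback_conn M (imm M) (E i) ?\<tau>) p (E i p) = mderiv M (\<lambda>q. - ?m *\<^sub>R ?A q) p (E i p)"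
    proof (rule mdiff_cong(2)[OF mdiff_scaleR_const(1)[OF A] D(1) U(1) _ Ei])
      fix q assume q: "q \<in> U"
      note q' = D(5)[OF q] and Eiq = D(3)[OF q i]
      have d: "?m *\<^sub>R mderiv M H q (E i q) \<in> tangent_space M q"
        by (intro subspace_scale subspace_tangent_space mderiv_mean_curvature_tangent q' Eiq)
      show "- ?m *\<^sub>R ?A q = pullback_conn M (imm M) (E i) ?\<tau> q"
        by (simp add: pullback_conn_def \<tau>[OF q' Eiq] orth_proj_sphere_of_tangent[OF q' d]
            weingarten_mean_curvature[where X = "E i", OF q' Eiq])
    qed
    also have "\<dots> = - ?m *\<^sub>R mderiv M ?A p (E i p)" by (rule mdiff_scaleR_const(2)[OF A Ei])
    finally show "pullback_conn M (imm M) (E i) (pullback_conn M (imm M) (E i) ?\<tau>) p =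
      - ?m *\<^sub>R ?S p (mderiv M (weingarten M H (E i)) p (E i p))"
      by (simp add: pullback_conn_def[of M "imm M" "E i" "pullback_conn M (imm M) (E i) ?\<tau>"]
          orth_proj_sphere[OF p] algebra_simps)
    note L = levi_civita_tangent[OF p, of "E i" "E i"]
    have d: "?m *\<^sub>R mderiv M H p (levi_civita M (E i) (E i) p) \<in> tangent_space M p"
      by (intro subspace_scale subspace_tangent_space mderiv_mean_curvature_tangent p L)
    show "pullback_conn M (imm M) (levi_civita M (E i) (E i)) ?\<tau> p =
      - ?m *\<^sub>R weingarten M H (levi_civita M (E i) (E i)) p"
      by (simp add: pullback_conn_def \<tau>[OF p L] orth_proj_sphere_of_tangent[OF p d]
          weingarten_mean_curvature[where X = "levi_civita M (E i) (E i)", OF p L])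
    note N = normal_spaceD[OF mean_curvature_normal[OF p]]
    \<comment> \<open>R(E_i, m H) E_i is <m H, E_i> E_i - <E_i, E_i> m H, and H is orthogonal to
      E_i.\<close>
    have "E i p \<bullet> E i p = 1" using D(4)[OF U(1) i i] by simp
    then show "sphere_curvature (imm M p) (dmap M (imm M) (E i) p) (?\<tau> p) (dmap M (imm M) (E i) p) =
      - ?m *\<^sub>R H p"
      by (simp add: dmap_def mderiv_imm[OF p Ei] tension_field_eq[OF p] sphere_curvature norm_imm[OF p]
          tangent_orthogonal_imm[OF p Ei] N(1) N(3)[OF Ei])
  qed
  have "bitension_field M (imm M) p = 0"
    using bih p by (simp add: biharmonic_map_def)
  then have "(\<Sum>i<DIM('m). - ?m *\<^sub>R (?S p (mderiv M (weingarten M H (E i)) p (E i p))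
      - weingarten M H (levi_civita M (E i) (E i)) p)) + (\<Sum>i<DIM('m). ?m *\<^sub>R H p) = 0"
    by (simp add: bitension_field_def rough_laplacian_def tr second first curv sum_negf scaleR_diff_right)
  \<comment> \<open>The curvature terms add up to m^2 H; the common factor m, positive as a
    dimension, is then cancelled.\<close>
  then have "?m *\<^sub>R (\<Sum>i<DIM('m). ?S p (mderiv M (weingarten M H (E i)) p (E i p))
      - weingarten M H (levi_civita M (E i) (E i)) p) = ?m *\<^sub>R (?m *\<^sub>R H p)"
    by (simp add: scaleR_sum_right[symmetric] sum_negf sum_constant_scaleR)
  then show ?thesis by (rule scaleR_left_imp_eq[rotated]) simp
qed

text \<open>Tangential projection turns the sphere's covariant derivative into that of M, so each
  summand of the biharmonic equation becomes (\<nabla>_(E_i) A_H) E_i, while the normal vector H is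
  sent to 0.\<close>

lemma trace_nabla_weingarten_zero:
  assumes bih: "biharmonic_map M (imm M)" and p: "p \<in> topspace (mtop M)"
  shows "trace_at M (nabla_weingarten M H) p = 0"
proof -
  define E where "E = (SOME E. \<exists>U. p \<in> U \<and> orthonormal_frame_on M U E)"
  let ?P = "orth_proj (tangent_space M p)"
  note P = orth_proj_tangent[OF p]
  have W: "?P (weingarten M H (levi_civita M (E i) (E i)) p) = weingarten M H (levi_civita M (E i) (E i)) p" for i
    by (intro P(4) weingarten_tangent p levi_civita_tangent)
  have "?P (H p) = 0"
    using normal_spaceD(3)[OF mean_curvature_normal[OF p]]
    by (intro orth_proj_eqI subspace_tangent_space p subspace_0) auto
  then have "0 = ?P (real DIM('m) *\<^sub>R H p)"
    by (simp add: linear_scale[OF P(3)])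
  also have "\<dots> = (\<Sum>i<DIM('m). nabla_weingarten M H (E i) (E i) p)"
    by (simp add: biharmonic_equation[OF assms, folded E_def, symmetric] linear_sum[OF P(3)]
        linear_diff[OF P(3)] orth_proj_tangent_sphere[OF p] nabla_weingarten_def levi_civita_eq[OF p] W)
  finally show ?thesis
    by (simp add: trace_at_frame(1)[OF p] E_def)
qed

text \<open>As A_H E_i is orthogonal to H, the pairing of its derivative along E_i with H is - <A_H
  E_i, D_(E_i) H> = |A_H E_i|^2. The term with \<nabla>_(E_i) E_i is tangent and drops out.\<close>

lemma weingarten_norm2_eq:
  assumes bih: "biharmonic_map M (imm M)" and p: "p \<in> topspace (mtop M)"
  shows "weingarten_norm2 M H p = real DIM('m) * (H p \<bullet> H p)"
proof -
  define E where "E = (SOME E. \<exists>U. p \<in> U \<and> orthonormal_frame_on M U E)"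
  have "\<exists>U. p \<in> U \<and> orthonormal_frame_on M U E"
    unfolding E_def by (rule trace_at_frame(2)[OF p])
  then obtain U where U: "p \<in> U" "orthonormal_frame_on M U E" by blast
  note D = orthonormal_frame_onD[OF U(2)]
  note N = normal_spaceD[OF mean_curvature_normal[OF p]]
  have "(orth_proj (sphere_tangent (imm M p)) (mderiv M (weingarten M H (E i)) p (E i p))
      - weingarten M H (levi_civita M (E i) (E i)) p) \<bullet> H p = weingarten M H (E i) p \<bullet> weingarten M H (E i) p"
    if i: "i < DIM('m)" for i
  proof -
    note A = tangent_field_weingarten[OF U(2) D(2)[OF i]]
    note Ei = D(3)[OF U(1) i]
    have "weingarten M H (E i) q \<bullet> H q = 0" if "q \<in> U" for q
      by (rule normal_spaceD(4)[OF mean_curvature_normal[OF D(5)[OF that]] tangent_field_onD(3)[OF A that]])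
    from mean_curvature_inner_mderiv[OF p D(1) U(1) tangent_field_on_mdiff[OF A U(1)] this Ei]
    have "mderiv M (weingarten M H (E i)) p (E i p) \<bullet> H p = weingarten M H (E i) p \<bullet> weingarten M H (E i) p"
      by (simp add: weingarten_mean_curvature[where X = "E i", OF p Ei])
    moreover have "weingarten M H (levi_civita M (E i) (E i)) p \<bullet> H p = 0"
      by (intro N(4) weingarten_tangent p levi_civita_tangent)
    ultimately show ?thesis
      by (simp add: orth_proj_sphere[OF p] inner_diff_left N(2))
  qed
  then have "weingarten_norm2 M H p = (\<Sum>i<DIM('m). orth_proj (sphere_tangent (imm M p))
      (mderiv M (weingarten M H (E i)) p (E i p)) - weingarten M H (levi_civita M (E i) (E i)) p) \<bullet> H p"
    by (simp add: weingarten_norm2_frame[OF U(2,1)] inner_sum_left)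
  then show ?thesis
    by (simp add: biharmonic_equation[OF assms, folded E_def])
qed

lemma weingarten_norm2_constant:
  assumes bih: "biharmonic_map M (imm M)"
  shows "\<exists>c. \<forall>p\<in>topspace (mtop M). weingarten_norm2 M H p = c"
proof -
  obtain c where "\<forall>p\<in>topspace (mtop M). H p \<bullet> H p = c"
    using mean_curvature_norm_constant by blast
  then show ?thesis
    by (intro exI[of _ "real DIM('m) * c"]) (simp add: weingarten_norm2_eq[OF bih])
qed

text \<open>Each summand is <D_X (A_H E_i), A_H E_i> minus <A_H (\<nabla>_X E_i), A_H E_i>. The
  first kind adds up to half the derivative of the constant |A_H|^2. For the second, expand
  \<nabla>_X E_i in the frame and use that its coefficients are skew.\<close>

lemma sum_nabla_weingarten_zero:
  assumes bih: "biharmonic_map M (imm M)" and E: "orthonormal_frame_on M U E"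
    and X: "tangent_field_on M U X" and pU: "p \<in> U"
  shows "(\<Sum>i<DIM('m). nabla_weingarten M H X (E i) p \<bullet> weingarten M H (E i) p) = 0"
proof -
  let ?A = "\<lambda>i. weingarten M H (E i)" and ?n = "DIM('m)"
  note D = orthonormal_frame_onD[OF E]
  note p = D(5)[OF pU]
  note Xp = tangent_field_onD(3)[OF X pU]
  note P = orth_proj_tangent[OF p]
  note H = mdiff_mean_curvature[OF p]
  have A: "mdiff (?A i) p" "?A i p \<in> tangent_space M p" if "i < ?n" for i
    using tangent_field_weingarten[OF E D(2)[OF that]] pU tangent_field_on_mdiff tangent_field_onD(3)
    by blast+
  have dE: "mdiff (E i) p" if "i < ?n" for i
    by (rule tangent_field_on_mdiff[OF D(2)[OF that] pU])
  define c where "c i j = mderiv M (E i) p (X p) \<bullet> E j p" for i j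
  have skew: "c i j = - c j i" if "i < ?n" "j < ?n" for i j
  proof -
    have "mderiv M (\<lambda>q. E i q \<bullet> E j q) p (X p) = mderiv M (\<lambda>q. if i = j then 1 else 0 :: real) p (X p)"
      by (rule mdiff_cong(2)[OF mdiff_const[OF p] D(1) pU _ Xp]) (simp add: D(4) that)
    then have "E i p \<bullet> mderiv M (E j) p (X p) + mderiv M (E i) p (X p) \<bullet> E j p = 0"
      by (simp only: mdiff_inner(2)[OF dE[OF that(1)] dE[OF that(2)] Xp] mderiv_const[OF p Xp])
    then show ?thesis by (simp add: c_def inner_commute[of "E i p"])
  qed
  have W: "weingarten M H (levi_civita M X (E i)) p = (\<Sum>j<?n. c i j *\<^sub>R ?A j p)" if i: "i < ?n" for i
  proof -
    have "mderiv M H p (\<Sum>j<?n. c i j *\<^sub>R E j p) = (\<Sum>j<?n. c i j *\<^sub>R mderiv M H p (E j p))"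
      by (rule mderiv_sum_vector[OF _ H]) (simp add: D(3)[OF pU])
    then show ?thesis
      by (simp add: weingarten_mean_curvature[OF p] levi_civita_tangent[OF p] D(3)[OF pU] sum_negf)
        (simp add: levi_civita_eq[OF p] orth_proj_tangent_frame[OF E pU] c_def)
  qed
  \<comment> \<open>Skew coefficients against symmetric inner products: swapping i and j shows that
    the double sum equals its own negative.\<close>
  have anti: "c i j * (?A j p \<bullet> ?A i p) = - (c j i * (?A i p \<bullet> ?A j p))" if "i < ?n" "j < ?n" for i j
    by (simp only: skew[OF that] inner_commute[of "?A j p"] mult_minus_left)
  have "(\<Sum>i<?n. \<Sum>j<?n. c i j * (?A j p \<bullet> ?A i p)) = (\<Sum>i<?n. \<Sum>j<?n. - (c j i * (?A i p \<bullet> ?A j p)))"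
    by (intro sum.cong refl anti) auto
  also have "\<dots> = - (\<Sum>j<?n. \<Sum>i<?n. c j i * (?A i p \<bullet> ?A j p))"
    by (subst sum.swap) (simp add: sum_negf)
  finally have connection: "(\<Sum>i<?n. weingarten M H (levi_civita M X (E i)) p \<bullet> ?A i p) = 0"
    by (simp add: W inner_sum_left)
  obtain k where k: "\<And>q. q \<in> topspace (mtop M) \<Longrightarrow> weingarten_norm2 M H q = k"
    using weingarten_norm2_constant[OF bih] by blast
  have "mderiv M (\<lambda>q. \<Sum>i<?n. ?A i q \<bullet> ?A i q) p (X p) = mderiv M (\<lambda>q. k) p (X p)"
    by (rule mdiff_cong(2)[OF mdiff_const[OF p] D(1) pU _ Xp])
      (simp add: weingarten_norm2_frame[OF E, symmetric] k D(5))
  moreover have "mderiv M (\<lambda>q. \<Sum>i<?n. ?A i q \<bullet> ?A i q) p (X p) =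
      (\<Sum>i<?n. mderiv M (\<lambda>q. ?A i q \<bullet> ?A i q) p (X p))"
    by (rule mdiff_sum(2)[OF p _ Xp]) (simp add: mdiff_inner(1) A)
  moreover have "mderiv M (\<lambda>q. ?A i q \<bullet> ?A i q) p (X p) = 2 * (mderiv M (?A i) p (X p) \<bullet> ?A i p)"
    if "i < ?n" for i
    by (simp add: mdiff_inner(2)[OF A(1)[OF that] A(1)[OF that] Xp] inner_commute)
  ultimately have diagonal: "(\<Sum>i<?n. mderiv M (?A i) p (X p) \<bullet> ?A i p) = 0"
    by (simp add: mderiv_const[OF p Xp] sum_distrib_left[symmetric])
  have "(\<Sum>i<?n. nabla_weingarten M H X (E i) p \<bullet> ?A i p) =
      (\<Sum>i<?n. mderiv M (?A i) p (X p) \<bullet> ?A i p - weingarten M H (levi_civita M X (E i)) p \<bullet> ?A i p)"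
    by (intro sum.cong refl)
      (simp add: nabla_weingarten_def levi_civita_eq[OF p, of X "weingarten M H _"] inner_diff_left P(2)[OF A(2)])
  then show ?thesis
    by (simp add: sum_subtractf diagonal connection)
qed

lemma trace_nabla_second_fundamental_form_zero:
  assumes bih: "biharmonic_map M (imm M)" and X: "tangent_field_on M (topspace (mtop M)) X"
    and p: "p \<in> topspace (mtop M)"
  shows "trace_at M (\<lambda>E F. nabla_second_fundamental_form M X E (weingarten M H F)) p \<bullet> H p = 0"
    and "trace_at M (\<lambda>E F. nabla_second_fundamental_form M E X (weingarten M H F)) p \<bullet> H p = 0"
proof -
  define E where "E = (SOME E. \<exists>U. p \<in> U \<and> orthonormal_frame_on M U E)"
  have "\<exists>U. p \<in> U \<and> orthonormal_frame_on M U E"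
    unfolding E_def by (rule trace_at_frame(2)[OF p])
  then obtain U where U: "p \<in> U" "orthonormal_frame_on M U E" by blast
  note D = orthonormal_frame_onD[OF U(2)]
  note tr = trace_at_frame(1)[OF p, folded E_def]
  have XU: "tangent_field_on M U X"
    by (rule tangent_field_on_subset[OF X D(1) openin_subset[OF D(1)]])
  have 1: "nabla_second_fundamental_form M X (E i) (weingarten M H (E i)) p \<bullet> H p =
      nabla_weingarten M H X (E i) p \<bullet> weingarten M H (E i) p" if "i < DIM('m)" for i
    by (intro nabla_second_fundamental_form_inner_mean_curvature[OF U(2)] XU D(2)[OF that]
        tangent_field_weingarten[OF U(2)] U(1))
  \<comment> \<open>Pairing with H first produces (\<nabla>_(E_i) A_H) X; the Codazzi equation turns
    it into (\<nabla>_X A_H) E_i, the summand of the other trace.\<close>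
  have 2: "nabla_second_fundamental_form M (E i) X (weingarten M H (E i)) p \<bullet> H p =
      nabla_weingarten M H X (E i) p \<bullet> weingarten M H (E i) p" if "i < DIM('m)" for i
    using nabla_second_fundamental_form_inner_mean_curvature[OF U(2) D(2)[OF that] XU
        tangent_field_weingarten[OF U(2) D(2)[OF that]] U(1)]
      nabla_weingarten_codazzi[OF U(2) XU D(2)[OF that] U(1)] by simp
  show "trace_at M (\<lambda>E F. nabla_second_fundamental_form M X E (weingarten M H F)) p \<bullet> H p = 0"
    using sum_nabla_weingarten_zero[OF bih U(2) XU U(1)] by (simp add: tr inner_sum_left 1)
  show "trace_at M (\<lambda>E F. nabla_second_fundamental_form M E X (weingarten M H F)) p \<bullet> H p = 0"
    using sum_nabla_weingarten_zero[OF bih U(2) XU U(1)] by (simp add: tr inner_sum_left 2)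
qed

end

theorem proposition3p1:
  fixes M :: "('a, 'm::euclidean_space, 'e::euclidean_space) mapped_manifold"
    and m n :: nat
  assumes dim_M: "DIM('m) = m"
    and dim_sphere: "DIM('e) = n + 1"
    and proper: "proper_biharmonic_submanifold M"
    and parallel: "parallel_mean_curvature M"
  defines "H \<equiv> mean_curvature M"
  shows "(\<forall>p\<in>topspace (mtop M). weingarten_norm2 M H p = real m * (norm (H p))\<^sup>2) \<and>
         (\<exists>c. \<forall>p\<in>topspace (mtop M). weingarten_norm2 M H p = c) \<and>
         (\<forall>p\<in>topspace (mtop M). trace_at M (nabla_weingarten M H) p = 0) \<and>
         (\<forall>X. tangent_field_on M (topspace (mtop M)) X \<longrightarrow>
            (\<forall>p\<in>topspace (mtop M).
               trace_at M (\<lambda>E F. nabla_second_fundamental_form M X E (weingarten M H F)) p \<bullet> H p = 0 \<and>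
               trace_at M (\<lambda>E F. nabla_second_fundamental_form M E X (weingarten M H F)) p \<bullet> H p = 0))"
proof -
  interpret parallel_immersion M
    using proper parallel by unfold_locales (simp_all add: proper_biharmonic_submanifold_def)
  have bih: "biharmonic_map M (imm M)"
    using proper by (simp add: proper_biharmonic_submanifold_def)
  show ?thesis
    unfolding H_def power2_norm_eq_inner dim_M[symmetric]
    using weingarten_norm2_eq[OF bih] weingarten_norm2_constant[OF bih]
      trace_nabla_weingarten_zero[OF bih] trace_nabla_second_fundamental_form_zero[OF bih] by blast
qed

end
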